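(* Let $\mathbf X=(X,\mathcal E)$ be a coarse space with decomposition $\mathbf X=\bigsqcup_{i\in I}\mathbf X_i$ in coarsely connected components, let $\mathcal H_{\mathbf X}$ be an admissible $\mathbf X$-module, and suppose that $X_i\subseteq X$ is measurable for all $i\in I$. Put $\mathcal H_i=\mathbb 1_{X_i}(\mathcal H_{\mathbf X})$. Then, for every Roe-like $*$-algebra $\mathcal R[\cdot]\in\{\mathbb C_{\mathrm{Roe}}[\cdot],\mathbb C_{\mathrm{cp}}[\cdot]\}$ and every Roe-like $C^*$-algebra $\mathcal R^*(\cdot)\in\{C^*_{\mathrm{Roe}}(\cdot),C^*_{\mathrm{cp}}(\cdot),C^*_{\mathrm{ql}}(\cdot)\}$, $$\mathbb 1_{X_i}\mathcal R[\mathcal H_{\mathbf X}]\mathbb 1_{X_i}=\mathcal R[\mathcal H_i]\quad\text{and}\quad \mathbb 1_{X_i}\mathcal R^*(\mathcal H_{\mathbf X})\mathbb 1_{X_i}=\mathcal R^*(\mathcal H_i)\qquad(i\in I).$$ Moreover, as subalgebras of $\prod_{i\in I}\mathcal B(\mathcal H_i)$, $$\mathbb C_{\mathrm{cp}}[\mathcal H_{\mathbf X}]=\{(t_i)_{i\in I}: \text{equi controlled and bounded}\},$$ $$\mathbb C_{\mathrm{Roe}}[\mathcal H_{\mathbf X}]=\{(t_i)_{i\in I}: \text{equi controlled, locally compact, and bounded}\},$$ $$C^*_{\mathrm{ql}}(\mathcal H_{\mathbf X})=\{(t_i)_{i\in I}: \text{equi quasi-local and bounded}\}.$$ Therefore $C^*_{\mathrm{cp}}(\mathcal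 H_{\mathbf X})$ is the norm closure of $\{(t_i)_{i\in I}:\text{equi controlled and bounded}\}$, and $C^*_{\mathrm{Roe}}(\mathcal H_{\mathbf X})$ is the norm closure of $\{(t_i)_{i\in I}:\text{equi controlled, locally compact, and bounded}\}$.
   Context: For relations $E,F\subseteq X\times X$: $E^T=\{(x,y):(y,x)\in E\}$, $E\circ F=\{(z,x):\exists y,(z,y)\in E,(y,x)\in F\}$, $E(A)=\{y:\exists a\in A,(y,a)\in E\}$; $B,A\subseteq X$ are $E$-separated if $B\cap E(A)=\emptyset$. A coarse structure on $X$ is a non-empty family $\mathcal E$ of subsets of $X\times X$, closed under subsets and finite unions, containing the diagonal $\Delta_X$, and closed under $E\mapsto E^T$ and composition. A gauge is a symmetric element of $\mathcal E$ containing $\Delta_X$. $A\subseteq X$ is $E$-bounded if $A\times A\subseteq E$, bounded if $A\times A\in\mathcal E$. A coarse space is coarsely connected if every finite subset is bounded. Subsets are coarsely disjoint if no bounded set meets both. The coarsely connected components are the unique partition $X=\bigsqcup_iX_i$ into pairwise coarsely disjoint sets such that the restriction of $\mathcal E$ to each $X_i$ makes it a coarsely connected coarse space $\mathbf X_i$. An $\mathbf X$-module consists of a Boolean algebra $\mathfrak A$ of subsets of $X$ with $X\in\mathfrak A$ (its members are called measurable), a Hilbert space $\mathcal H$, and a map $\mathbb 1_\bullet$ from $\mathfrak A$ to projections in $\mathcal B(\mathcal H)$ with $\mathbb 1_\emptyset=0$, $\mathbb 1_X=1$, $\mathbb 1_{A\cap B}=\mathbb 1_A\mathbb 1_B$,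 $\mathbb 1_{A\cup B}=\mathbb 1_A+\mathbb 1_B-\mathbb 1_A\mathbb 1_B$, non-degenerate in the sense that for some gauge $\widetilde E$ the subspaces $\mathbb 1_A(\mathcal H)$ with $A$ measurable and $\widetilde E$-bounded span a dense subspace. It is admissible if there is a gauge $\widetilde E$ such that for every $B\subseteq X$ there is a measurable $A$ with $B\subseteq A\subseteq\widetilde E(B)$. $\mathcal H_i$ is regarded as an $\mathbf X_i$-module by restricting $\mathbb 1_\bullet$ to the measurable subsets of $X_i$ (or, equivalently for our purposes, as an $\mathbf X$-module); operators on $\mathcal H_i$ are extended by $0$ to $\mathcal H_{\mathbf X}$, and $\prod_i\mathcal B(\mathcal H_i)\subseteq\mathcal B(\mathcal H_{\mathbf X})$ acts diagonally, bounded families $(t_i)_i$ corresponding to strong sums $\sum_it_i$. For $t\in\mathcal B(\mathcal H)$, $\mathrm{Supp}(t)\subseteq E$ means $\mathbb 1_Bt\mathbb 1_A=0$ for all $E$-separated measurable $B,A$; $t$ has controlled propagation if $\mathrm{Supp}(t)\subseteq E$ for some $E\in\mathcal E$. $t$ is $\varepsilon$-$E$-quasi-local if $\|\mathbb 1_{A'}t\mathbb 1_A\|\le\varepsilon$ for all $E$-separated measurable $A',A$; it is quasi-local if for every $\varepsilon>0$ it is $\varepsilon$-$E$-quasi-local for some $E\in\mathcal E$. $t$ is locally compact if $\mathbb 1_At$ and $t\mathbb 1_A$ are compact for every bounded measurable $A$. $\mathbb C_{\mathrm{cp}}[\mathcal H]$ is the $*$-algebra of operators of controlled propagation, $\mathbb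 C_{\mathrm{Roe}}[\mathcal H]$ that of locally compact operators of controlled propagation; $C^*_{\mathrm{cp}}(\mathcal H)$ and $C^*_{\mathrm{Roe}}(\mathcal H)$ are their norm closures; $C^*_{\mathrm{ql}}(\mathcal H)$ is the set of quasi-local operators. A family $(t_i)_{i\in I}$ with $t_i\in\mathcal B(\mathcal H_i)$ is: equi controlled if there is a single $E\in\mathcal E$ with $\mathrm{Supp}(t_i)\subseteq E$ for all $i$; equi quasi-local if for every $\varepsilon>0$ there is $E\in\mathcal E$ such that every $t_i$ is $\varepsilon$-$E$-quasi-local; locally compact if every $t_i$ is; bounded if $\sup_i\|t_i\|<\infty$. *)

theory Defs
  imports "HOL-Analysis.Analysis"
begin

section \<open>Complex Hilbert spaces\<close>

text \<open>The inner product is conjugate linear in its first argument.\<close>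

class chilbert_space = banach +
  fixes scaleC :: "complex \<Rightarrow> 'a \<Rightarrow> 'a" (infixr \<open>*\<^sub>C\<close> 75)
    and cinner :: "'a \<Rightarrow> 'a \<Rightarrow> complex"
  assumes scaleC_add_right: "c *\<^sub>C (x + y) = c *\<^sub>C x + c *\<^sub>C y"
    and scaleC_add_left: "(c + d) *\<^sub>C x = c *\<^sub>C x + d *\<^sub>C x"
    and scaleC_scaleC: "c *\<^sub>C d *\<^sub>C x = (c * d) *\<^sub>C x"
    and scaleR_scaleC: "r *\<^sub>R x = complex_of_real r *\<^sub>C x"
    and cinner_commute: "cinner x y = cnj (cinner y x)"
    and cinner_add_right: "cinner x (y + z) = cinner x y + cinner x z"
    and cinner_scaleC_right: "cinner x (c *\<^sub>C y) = c * cinner x y"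
    and cinner_self: "cinner x x = complex_of_real ((norm x)\<^sup>2)"

interpretation complex_vector:
  vector_space "scaleC :: complex \<Rightarrow> 'a \<Rightarrow> 'a::chilbert_space"
proof
  show "1 *\<^sub>C x = x" for x :: 'a
    using scaleR_scaleC[of 1 x] by simp
qed (simp_all add: scaleC_add_right scaleC_add_left scaleC_scaleC)

text \<open>
  Hilbert spaces occur as closed complex subspaces \<open>S\<close> of an ambient Hilbert space type.
  \<open>operators_on S\<close> is the set of bounded complex linear operators on \<open>S\<close>, each extended
  by \<open>0\<close> on the orthogonal complement of \<open>S\<close>. The extension preserves sums, products,
  operator norms and compactness, and the set is norm closed, so all of these may be computed
  in the ambient space.
\<close>

definition operators_on :: "'h::chilbert_space set \<Rightarrow> ('h \<Rightarrow>\<^sub>L 'h) set" where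
  "operators_on S = {t :: 'h \<Rightarrow>\<^sub>L 'h. (\<forall>c v. t (c *\<^sub>C v) = c *\<^sub>C t v) \<and> (\<forall>v. t v \<in> S) \<and>
     (\<forall>v. (\<forall>w\<in>S. cinner w v = 0) \<longrightarrow> t v = 0)}"

definition projection :: "('h::chilbert_space \<Rightarrow>\<^sub>L 'h) \<Rightarrow> bool" where
  "projection p \<longleftrightarrow> p o\<^sub>L p = p \<and> (\<forall>v w. cinner (blinfun_apply p v) w = cinner v (blinfun_apply p w))"

definition compact_operator :: "('h::chilbert_space \<Rightarrow>\<^sub>L 'h) \<Rightarrow> bool" where
  "compact_operator t \<longleftrightarrow> compact (closure (blinfun_apply t ` cball 0 1))"

section \<open>Coarse spaces\<close>

record 'x coarse =
  points :: "'x set"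
  entourages :: "('x \<times> 'x) set set"

definition coarse_space :: "'x coarse \<Rightarrow> bool" where
  "coarse_space \<X> \<longleftrightarrow>
     entourages \<X> \<noteq> {} \<and> entourages \<X> \<subseteq> Pow (points \<X> \<times> points \<X>) \<and>
     (\<forall>E\<in>entourages \<X>. \<forall>F. F \<subseteq> E \<longrightarrow> F \<in> entourages \<X>) \<and>
     (\<forall>E\<in>entourages \<X>. \<forall>F\<in>entourages \<X>. E \<union> F \<in> entourages \<X>) \<and>
     Id_on (points \<X>) \<in> entourages \<X> \<and>
     (\<forall>E\<in>entourages \<X>. E\<inverse> \<in> entourages \<X>) \<and>
     (\<forall>E\<in>entourages \<X>. \<forall>F\<in>entourages \<X>. E O F \<in> entourages \<X>)"

definition gauge_of :: "'x coarse \<Rightarrow> ('x \<times> 'x) set \<Rightarrow> bool" where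
  "gauge_of \<X> E \<longleftrightarrow> E \<in> entourages \<X> \<and> sym E \<and> Id_on (points \<X>) \<subseteq> E"

text \<open>The second coordinate is the source: \<open>E(A)\<close> is \<open>E\<inverse> `` A\<close>, not \<open>E `` A\<close>.\<close>

definition thicken :: "('x \<times> 'x) set \<Rightarrow> 'x set \<Rightarrow> 'x set" where
  "thicken E A = {y. \<exists>a\<in>A. (y, a) \<in> E}"

definition separated :: "('x \<times> 'x) set \<Rightarrow> 'x set \<Rightarrow> 'x set \<Rightarrow> bool" where
  "separated E B A \<longleftrightarrow> B \<inter> thicken E A = {}"

definition coarsely_bounded :: "'x coarse \<Rightarrow> 'x set \<Rightarrow> bool" where
  "coarsely_bounded \<X> A \<longleftrightarrow> A \<times> A \<in> entourages \<X>"

definition coarsely_connected :: "'x coarse \<Rightarrow> bool" where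
  "coarsely_connected \<X> \<longleftrightarrow> (\<forall>A. finite A \<and> A \<subseteq> points \<X> \<longrightarrow> coarsely_bounded \<X> A)"

definition coarsely_disjoint :: "'x coarse \<Rightarrow> 'x set \<Rightarrow> 'x set \<Rightarrow> bool" where
  "coarsely_disjoint \<X> A B \<longleftrightarrow>
     \<not> (\<exists>C. coarsely_bounded \<X> C \<and> C \<inter> A \<noteq> {} \<and> C \<inter> B \<noteq> {})"

definition coarse_restrict :: "'x coarse \<Rightarrow> 'x set \<Rightarrow> 'x coarse" where
  "coarse_restrict \<X> Y =
     \<lparr>points = Y, entourages = (\<lambda>E. E \<inter> (Y \<times> Y)) ` entourages \<X>\<rparr>"

definition coarse_components :: "'x coarse \<Rightarrow> 'i set \<Rightarrow> ('i \<Rightarrow> 'x set) \<Rightarrow> bool" where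
  "coarse_components \<X> I X \<longleftrightarrow>
     (\<Union>i\<in>I. X i) = points \<X> \<and> disjoint_family_on X I \<and> (\<forall>i\<in>I. X i \<noteq> {}) \<and>
     (\<forall>i\<in>I. \<forall>j\<in>I. i \<noteq> j \<longrightarrow> coarsely_disjoint \<X> (X i) (X j)) \<and>
     (\<forall>i\<in>I. coarse_space (coarse_restrict \<X> (X i)) \<and>
            coarsely_connected (coarse_restrict \<X> (X i)))"

section \<open>Modules over coarse spaces\<close>

text \<open>\<open>proj M A\<close> is meaningful for measurable \<open>A\<close> only.\<close>

record (overloaded) ('x, 'h) cmodule =
  meas :: "'x set set"
  hilb :: "'h set"
  proj :: "'x set \<Rightarrow> 'h::chilbert_space \<Rightarrow>\<^sub>L 'h"

definition coarse_module :: "'x coarse \<Rightarrow> ('x, 'h::chilbert_space) cmodule \<Rightarrow> bool" where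
  "coarse_module \<X> M \<longleftrightarrow>
     algebra (points \<X>) (meas M) \<and>
     complex_vector.subspace (hilb M) \<and> closed (hilb M) \<and>
     (\<forall>A\<in>meas M. proj M A \<in> operators_on (hilb M) \<and> projection (proj M A)) \<and>
     proj M {} = 0 \<and>
     (\<forall>v\<in>hilb M. proj M (points \<X>) v = v) \<and>
     (\<forall>A\<in>meas M. \<forall>B\<in>meas M. proj M (A \<inter> B) = proj M A o\<^sub>L proj M B) \<and>
     (\<forall>A\<in>meas M. \<forall>B\<in>meas M.
        proj M (A \<union> B) = proj M A + proj M B - (proj M A o\<^sub>L proj M B)) \<and>
     (\<exists>E. gauge_of \<X> E \<and>
        closure (complex_vector.span (\<Union>A\<in>{A\<in>meas M. A \<times> A \<subseteq> E}. proj M A ` hilb M)) = hilb M)"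

definition admissible :: "'x coarse \<Rightarrow> ('x, 'h::chilbert_space) cmodule \<Rightarrow> bool" where
  "admissible \<X> M \<longleftrightarrow>
     (\<exists>E. gauge_of \<X> E \<and> (\<forall>B\<subseteq>points \<X>. \<exists>A\<in>meas M. B \<subseteq> A \<and> A \<subseteq> thicken E B))"

definition module_restrict ::
    "('x, 'h::chilbert_space) cmodule \<Rightarrow> 'x set \<Rightarrow> ('x, 'h) cmodule" where
  "module_restrict M Y =
     \<lparr>meas = {A\<in>meas M. A \<subseteq> Y}, hilb = proj M Y ` hilb M, proj = proj M\<rparr>"

section \<open>Roe-like algebras\<close>

definition supp_in ::
    "('x, 'h::chilbert_space) cmodule \<Rightarrow> ('h \<Rightarrow>\<^sub>L 'h) \<Rightarrow> ('x \<times> 'x) set \<Rightarrow> bool" where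
  "supp_in M t E \<longleftrightarrow>
     (\<forall>B\<in>meas M. \<forall>A\<in>meas M. separated E B A \<longrightarrow> proj M B o\<^sub>L t o\<^sub>L proj M A = 0)"

definition quasi_local_at ::
    "('x, 'h::chilbert_space) cmodule \<Rightarrow> ('h \<Rightarrow>\<^sub>L 'h) \<Rightarrow> real \<Rightarrow> ('x \<times> 'x) set \<Rightarrow> bool" where
  "quasi_local_at M t \<epsilon> E \<longleftrightarrow>
     (\<forall>B\<in>meas M. \<forall>A\<in>meas M. separated E B A \<longrightarrow> norm (proj M B o\<^sub>L t o\<^sub>L proj M A) \<le> \<epsilon>)"

definition locally_compact_operator ::
    "'x coarse \<Rightarrow> ('x, 'h::chilbert_space) cmodule \<Rightarrow> ('h \<Rightarrow>\<^sub>L 'h) \<Rightarrow> bool" where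
  "locally_compact_operator \<X> M t \<longleftrightarrow>
     (\<forall>A\<in>meas M. coarsely_bounded \<X> A \<longrightarrow>
        compact_operator (proj M A o\<^sub>L t) \<and> compact_operator (t o\<^sub>L proj M A))"

definition cp_alg :: "'x coarse \<Rightarrow> ('x, 'h::chilbert_space) cmodule \<Rightarrow> ('h \<Rightarrow>\<^sub>L 'h) set" where
  "cp_alg \<X> M = {t \<in> operators_on (hilb M). \<exists>E\<in>entourages \<X>. supp_in M t E}"

definition Roe_alg :: "'x coarse \<Rightarrow> ('x, 'h::chilbert_space) cmodule \<Rightarrow> ('h \<Rightarrow>\<^sub>L 'h) set" where
  "Roe_alg \<X> M = {t \<in> cp_alg \<X> M. locally_compact_operator \<X> M t}"

definition cp_Cstar :: "'x coarse \<Rightarrow> ('x, 'h::chilbert_space) cmodule \<Rightarrow> ('h \<Rightarrow>\<^sub>L 'h) set" where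
  "cp_Cstar \<X> M = closure (cp_alg \<X> M)"

definition Roe_Cstar :: "'x coarse \<Rightarrow> ('x, 'h::chilbert_space) cmodule \<Rightarrow> ('h \<Rightarrow>\<^sub>L 'h) set" where
  "Roe_Cstar \<X> M = closure (Roe_alg \<X> M)"

definition ql_Cstar :: "'x coarse \<Rightarrow> ('x, 'h::chilbert_space) cmodule \<Rightarrow> ('h \<Rightarrow>\<^sub>L 'h) set" where
  "ql_Cstar \<X> M =
     {t \<in> operators_on (hilb M). \<forall>\<epsilon>>0. \<exists>E\<in>entourages \<X>. quasi_local_at M t \<epsilon> E}"

section \<open>Families of operators\<close>

text \<open>
  Bounded families, with values outside \<open>I\<close> fixed; \<open>strong_sum\<close> embeds them in the operators on
  \<open>hilb M\<close> as block diagonal operators.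
\<close>

definition operator_product ::
    "('x, 'h::chilbert_space) cmodule \<Rightarrow> 'i set \<Rightarrow> ('i \<Rightarrow> 'x set) \<Rightarrow> ('i \<Rightarrow> 'h \<Rightarrow>\<^sub>L 'h) set" where
  "operator_product M I X =
     {t \<in> (\<Pi>\<^sub>E i\<in>I. operators_on (hilb (module_restrict M (X i)))).
        bdd_above ((\<lambda>i. norm (t i)) ` I)}"

definition is_strong_sum ::
    "'i set \<Rightarrow> ('i \<Rightarrow> 'h::chilbert_space \<Rightarrow>\<^sub>L 'h) \<Rightarrow> ('h \<Rightarrow>\<^sub>L 'h) \<Rightarrow> bool" where
  "is_strong_sum I t s \<longleftrightarrow> (\<forall>v. ((\<lambda>i. t i v) has_sum s v) I)"

definition strong_sum ::
    "'i set \<Rightarrow> ('i \<Rightarrow> 'h::chilbert_space \<Rightarrow>\<^sub>L 'h) \<Rightarrow> 'h \<Rightarrow>\<^sub>L 'h" where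
  "strong_sum I t = (THE s. is_strong_sum I t s)"

definition equi_controlled ::
    "'x coarse \<Rightarrow> ('x, 'h::chilbert_space) cmodule \<Rightarrow> 'i set \<Rightarrow> ('i \<Rightarrow> 'x set) \<Rightarrow>
     ('i \<Rightarrow> 'h \<Rightarrow>\<^sub>L 'h) \<Rightarrow> bool" where
  "equi_controlled \<X> M I X t \<longleftrightarrow>
     (\<exists>E\<in>entourages \<X>. \<forall>i\<in>I. supp_in (module_restrict M (X i)) (t i) E)"

definition equi_quasi_local ::
    "'x coarse \<Rightarrow> ('x, 'h::chilbert_space) cmodule \<Rightarrow> 'i set \<Rightarrow> ('i \<Rightarrow> 'x set) \<Rightarrow>
     ('i \<Rightarrow> 'h \<Rightarrow>\<^sub>L 'h) \<Rightarrow> bool" where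
  "equi_quasi_local \<X> M I X t \<longleftrightarrow>
     (\<forall>\<epsilon>>0. \<exists>E\<in>entourages \<X>. \<forall>i\<in>I. quasi_local_at (module_restrict M (X i)) (t i) \<epsilon> E)"

definition locally_compact_family ::
    "'x coarse \<Rightarrow> ('x, 'h::chilbert_space) cmodule \<Rightarrow> 'i set \<Rightarrow> ('i \<Rightarrow> 'x set) \<Rightarrow>
     ('i \<Rightarrow> 'h \<Rightarrow>\<^sub>L 'h) \<Rightarrow> bool" where
  "locally_compact_family \<X> M I X t \<longleftrightarrow>
     (\<forall>i\<in>I. locally_compact_operator (coarse_restrict \<X> (X i)) (module_restrict M (X i)) (t i))"

end

theory Submission
  imports Defs
begin

text \<open>
  Two points related by an entourage form a bounded pair, so entourages never leave a component.
  Hence a component and its complement are separated by every entourage, and the off-diagonal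
  corners of a quasi-local operator have norm at most every \<open>\<epsilon> > 0\<close>: it commutes with the
  projections \<open>P i\<close> of the components. By non-degeneracy these sum strongly to the identity, which
  recovers the operator from its corners. Conversely, a bounded family of corners has a strong sum
  whose norm is bounded by those of the blocks, by Bessel's inequality. Applied to the corners
  \<open>proj M B o\<^sub>L t o\<^sub>L proj M A\<close>, this bound reduces propagation and quasi-locality to
  the blocks, controlled propagation being the case \<open>\<epsilon> = 0\<close> of quasi-locality.
\<close>

section \<open>Orthogonal sums in Hilbert spaces\<close>

lemma cinner_add_left: "cinner (x + y) z = cinner x z + cinner y (z :: 'h::chilbert_space)"
  by (metis cinner_add_right cinner_commute complex_cnj_add)

lemma cinner_zero_right [simp]: "cinner x (0 :: 'h::chilbert_space) = 0"
  using cinner_add_right[of x 0 0] by simp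

lemma cinner_zero_left [simp]: "cinner (0 :: 'h::chilbert_space) x = 0"
  using cinner_add_left[of 0 0 x] by simp

lemma cinner_sum_right:
  "cinner x (\<Sum>i\<in>F. f i) = (\<Sum>i\<in>F. cinner x (f i :: 'h::chilbert_space))"
  by (induction F rule: infinite_finite_induct) (auto simp: cinner_add_right)

lemma cinner_eq_zero_iff [simp]: "cinner x x = 0 \<longleftrightarrow> x = (0 :: 'h::chilbert_space)"
  by (simp add: cinner_self)

text \<open>For non-real scalars the class axioms tie the norm to scaling only through the inner
  product, so homogeneity is read off from \<open>cinner_self\<close>.\<close>

lemma norm_scaleC: "norm (c *\<^sub>C x) = cmod c * norm (x :: 'h::chilbert_space)"
proof -
  have "cinner (c *\<^sub>C x) (c *\<^sub>C x) = c * cnj c * cinner x x"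
    by (metis (no_types, lifting) cinner_commute cinner_scaleC_right complex_cnj_mult mult.assoc)
  also have "\<dots> = complex_of_real ((cmod c * norm x)\<^sup>2)"
    by (simp only: cinner_self complex_norm_square[symmetric] of_real_mult[symmetric]
        power_mult_distrib)
  finally have "(norm (c *\<^sub>C x))\<^sup>2 = (cmod c * norm x)\<^sup>2"
    by (simp only: cinner_self of_real_eq_iff)
  then show ?thesis
    by (simp add: power2_eq_iff_nonneg)
qed

lemma bounded_linear_scaleC: "bounded_linear (\<lambda>x :: 'h::chilbert_space. c *\<^sub>C x)"
proof (rule bounded_linear_intro[where K = "cmod c"])
  show "c *\<^sub>C (r *\<^sub>R x) = r *\<^sub>R c *\<^sub>C x" for r and x :: 'h
    by (simp add: scaleR_scaleC scaleC_scaleC mult.commute)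
qed (simp_all add: scaleC_add_right norm_scaleC mult.commute)

lemma norm_add_orthogonal:
  assumes "cinner x y = 0"
  shows "(norm (x + y))\<^sup>2 = (norm x)\<^sup>2 + (norm (y :: 'h::chilbert_space))\<^sup>2"
proof -
  have "cinner y x = 0"
    using assms by (metis cinner_commute complex_cnj_zero)
  with assms have "cinner (x + y) (x + y) = cinner x x + cinner y y"
    by (simp add: cinner_add_left cinner_add_right)
  then show ?thesis
    by (simp only: cinner_self of_real_add[symmetric] of_real_eq_iff)
qed

lemma norm_sum_orthogonal:
  fixes f :: "'i \<Rightarrow> 'h::chilbert_space"
  assumes "finite F" and "\<And>i j. \<lbrakk>i \<in> F; j \<in> F; i \<noteq> j\<rbrakk> \<Longrightarrow> cinner (f i) (f j) = 0"
  shows "(norm (\<Sum>i\<in>F. f i))\<^sup>2 = (\<Sum>i\<in>F. (norm (f i))\<^sup>2)"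
  using assms
proof (induction F rule: finite_induct)
  case (insert i F)
  have "cinner (f i) (\<Sum>j\<in>F. f j) = 0"
    unfolding cinner_sum_right using insert by (intro sum.neutral) auto
  then show ?case
    using insert by (simp add: norm_add_orthogonal)
qed simp

text \<open>Cauchy criterion for unconditional sums: any two finite partial sums containing
  \<open>F\<^sub>0\<close> differ from the one over \<open>F\<^sub>0\<close> by small tails, and
  completeness supplies the limit.\<close>

lemma summable_on_small_tails:
  fixes f :: "'i \<Rightarrow> 'b::banach"
  assumes "\<And>e. e > 0 \<Longrightarrow> \<exists>F\<^sub>0. finite F\<^sub>0 \<and> F\<^sub>0 \<subseteq> I \<and>
    (\<forall>F. finite F \<and> F \<subseteq> I - F\<^sub>0 \<longrightarrow> norm (sum f F) < e)"
  shows "f summable_on I"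
proof -
  have "\<exists>P. eventually P (finite_subsets_at_top I) \<and>
      (\<forall>F G. P F \<and> P G \<longrightarrow> dist (sum f F) (sum f G) < e)" if "e > 0" for e
  proof -
    from assms[of "e / 2"] that obtain F\<^sub>0
      where F\<^sub>0: "finite F\<^sub>0" "F\<^sub>0 \<subseteq> I"
        and small: "\<And>F. \<lbrakk>finite F; F \<subseteq> I - F\<^sub>0\<rbrakk> \<Longrightarrow> norm (sum f F) < e / 2"
      by auto
    let ?P = "\<lambda>F. finite F \<and> F\<^sub>0 \<subseteq> F \<and> F \<subseteq> I"
    have near: "dist (sum f F) (sum f F\<^sub>0) < e / 2" if "?P F" for F
      using small[of "F - F\<^sub>0"] that by (auto simp: dist_norm sum_diff)
    show ?thesis
    proof (intro exI[of _ ?P] conjI allI impI)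
      show "eventually ?P (finite_subsets_at_top I)"
        using F\<^sub>0 by (auto simp: eventually_finite_subsets_at_top)
      show "dist (sum f F) (sum f G) < e" if "?P F \<and> ?P G" for F G
        using near[OF conjunct1[OF that]] near[OF conjunct2[OF that]]
        by (rule dist_triangle_half_l)
    qed
  qed
  then have "cauchy_filter (filtermap (sum f) (finite_subsets_at_top I))"
    by (simp add: cauchy_filter_metric_filtermap)
  moreover have "complete (UNIV :: 'b set)"
    by (meson Cauchy_convergent UNIV_I complete_def convergent_def)
  ultimately obtain l where "(sum f \<longlongrightarrow> l) (finite_subsets_at_top I)"
    using complete_uniform[where S = UNIV] by (force simp: filterlim_def)
  then show ?thesis
    using summable_on_def has_sum_def by blast
qed

text \<open>Pythagoras turns norms of finite sums into sums of squares. Once the squares over a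
  finite set come within \<open>e\<^sup>2\<close> of their supremum, every finite set disjoint from
  it contributes less than \<open>e\<^sup>2\<close>.\<close>

lemma summable_on_orthogonal:
  fixes f :: "'i \<Rightarrow> 'h::chilbert_space"
  assumes orth: "\<And>i j. \<lbrakk>i \<in> I; j \<in> I; i \<noteq> j\<rbrakk> \<Longrightarrow> cinner (f i) (f j) = 0"
    and bound: "\<And>F. \<lbrakk>finite F; F \<subseteq> I\<rbrakk> \<Longrightarrow> (\<Sum>i\<in>F. (norm (f i))\<^sup>2) \<le> K"
  shows "f summable_on I"
proof (rule summable_on_small_tails)
  fix e :: real
  assume "e > 0"
  let ?s = "\<lambda>F. \<Sum>i\<in>F. (norm (f i))\<^sup>2"
  let ?\<F> = "{F. finite F \<and> F \<subseteq> I}"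
  have bdd: "bdd_above (?s ` ?\<F>)"
    using bound by (auto intro!: bdd_aboveI)
  have ne: "?s ` ?\<F> \<noteq> {}"
    by blast
  have "(SUP F\<in>?\<F>. ?s F) - e\<^sup>2 < (SUP F\<in>?\<F>. ?s F)"
    using \<open>e > 0\<close> by simp
  then obtain F\<^sub>0 where F\<^sub>0: "finite F\<^sub>0" "F\<^sub>0 \<subseteq> I" and near: "(SUP F\<in>?\<F>. ?s F) - e\<^sup>2 < ?s F\<^sub>0"
    using less_cSup_iff[OF ne bdd] by auto
  have "norm (sum f F) < e" if "finite F" "F \<subseteq> I - F\<^sub>0" for F
  proof -
    have "?s F\<^sub>0 + ?s F = ?s (F\<^sub>0 \<union> F)"
      using F\<^sub>0 that by (intro sum.union_disjoint[symmetric]) auto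
    also have "\<dots> \<le> (SUP F\<in>?\<F>. ?s F)"
      using F\<^sub>0 that by (intro cSUP_upper[OF _ bdd]) auto
    finally have "?s F < e\<^sup>2"
      using near by simp
    moreover have "(norm (sum f F))\<^sup>2 = ?s F"
      using that orth by (intro norm_sum_orthogonal) auto
    ultimately show ?thesis
      using \<open>e > 0\<close> by (intro power2_less_imp_less[of _ e]) simp_all
  qed
  with F\<^sub>0 show "\<exists>F\<^sub>0. finite F\<^sub>0 \<and> F\<^sub>0 \<subseteq> I \<and>
      (\<forall>F. finite F \<and> F \<subseteq> I - F\<^sub>0 \<longrightarrow> norm (sum f F) < e)"
    by blast
qed

section \<open>Projections, operators on their ranges, and Bessel's inequality\<close>

lemma projection_apply_eq: "projection p \<Longrightarrow> p (p v) = p v"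
  unfolding projection_def by (metis blinfun_apply_blinfun_compose)

lemma projection_cinner: "projection p \<Longrightarrow> cinner (p v) w = cinner v (p w)"
  unfolding projection_def by blast

text \<open>Since \<open>v - p v\<close> is orthogonal to the range of \<open>p\<close>, vanishing
  on the orthogonal complement amounts to \<open>t o\<^sub>L p = t\<close>. This trades the
  orthogonality condition in \<open>operators_on\<close> for equations between operators.\<close>

lemma operators_on_range_iff:
  assumes p: "projection p"
  shows "t \<in> operators_on (range p) \<longleftrightarrow>
    (\<forall>c v. t (c *\<^sub>C v) = c *\<^sub>C t v) \<and> p o\<^sub>L t = t \<and> t o\<^sub>L p = t"
    (is "?L \<longleftrightarrow> ?R")
proof
  assume ?L
  have "p (t v) = t v" for v
    using \<open>?L\<close> projection_apply_eq[OF p] unfolding operators_on_def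
    by (metis (mono_tags, lifting) mem_Collect_eq rangeE)
  moreover have "t (p v) = t v" for v
  proof -
    have "cinner (p w) (v - p v) = 0" for w
      by (simp add: projection_cinner[OF p] blinfun.diff_right projection_apply_eq[OF p])
    then have "t (v - p v) = 0"
      using \<open>?L\<close> unfolding operators_on_def by auto
    then show ?thesis
      by (simp add: blinfun.diff_right)
  qed
  moreover have "\<forall>c v. t (c *\<^sub>C v) = c *\<^sub>C t v"
    using \<open>?L\<close> unfolding operators_on_def by blast
  ultimately show ?R
    by (auto intro!: blinfun_eqI)
next
  assume ?R
  then have tp: "t (p v) = t v" and pt: "p (t v) = t v" for v
    by (metis blinfun_apply_blinfun_compose)+
  have "t v \<in> range p" for v
    using pt[of v] by (metis rangeI)
  moreover have "t v = 0" if "\<forall>w\<in>range p. cinner w v = 0" for v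
  proof -
    have "cinner (p v) (p v) = cinner (p (p v)) v"
      by (simp only: projection_cinner[OF p])
    then have "p v = 0"
      using that by auto
    then show ?thesis
      using tp[of v] by (simp add: blinfun.zero_right)
  qed
  ultimately show ?L
    using \<open>?R\<close> unfolding operators_on_def by blast
qed

text \<open>Each \<open>P i\<close> kills the difference of \<open>v\<close> and the sum
  \<open>?u\<close> of its components, so the difference is orthogonal to \<open>?u\<close> and
  Pythagoras applies twice.\<close>

lemma bessel_inequality:
  fixes P :: "'i \<Rightarrow> 'h::chilbert_space \<Rightarrow>\<^sub>L 'h"
  assumes proj: "\<And>i. i \<in> F \<Longrightarrow> projection (P i)"
    and orth: "\<And>i j. \<lbrakk>i \<in> F; j \<in> F; i \<noteq> j\<rbrakk> \<Longrightarrow> P i o\<^sub>L P j = 0"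
    and "finite F"
  shows "(\<Sum>i\<in>F. (norm (P i v))\<^sup>2) \<le> (norm v)\<^sup>2"
proof -
  let ?u = "\<Sum>i\<in>F. P i v"
  have disj: "P i (P j w) = 0" if "i \<in> F" "j \<in> F" "i \<noteq> j" for i j w
    using orth[OF that] by (metis blinfun_apply_blinfun_compose zero_blinfun.rep_eq)
  have fix_u: "P i ?u = P i v" if "i \<in> F" for i
  proof -
    have "P i ?u = (\<Sum>j\<in>F. if j = i then P i v else 0)"
      unfolding blinfun.sum_right
      using that proj disj by (intro sum.cong) (auto simp: projection_apply_eq)
    then show ?thesis
      using that \<open>finite F\<close> by simp
  qed
  have "cinner (v - ?u) ?u = (\<Sum>i\<in>F. cinner (P i (v - ?u)) v)"
    unfolding cinner_sum_right using proj by (simp add: projection_cinner)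
  also have "\<dots> = 0"
    using fix_u by (intro sum.neutral) (simp add: blinfun.diff_right)
  finally have "(norm v)\<^sup>2 = (norm (v - ?u))\<^sup>2 + (norm ?u)\<^sup>2"
    using norm_add_orthogonal[of "v - ?u" ?u] by simp
  moreover have "(norm ?u)\<^sup>2 = (\<Sum>i\<in>F. (norm (P i v))\<^sup>2)"
    using \<open>finite F\<close> proj disj by (intro norm_sum_orthogonal) (auto simp: projection_cinner)
  ultimately show ?thesis
    by simp
qed

section \<open>Strong sums of operators\<close>

lemma strong_sum_eqI: "is_strong_sum I t s \<Longrightarrow> strong_sum I t = s"
  unfolding strong_sum_def
  by (rule the_equality) (auto simp: is_strong_sum_def intro!: blinfun_eqI has_sum_unique)

lemma is_strong_sum_unique: "\<lbrakk>is_strong_sum I t s; is_strong_sum I t s'\<rbrakk> \<Longrightarrow> s = s'"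
  using strong_sum_eqI by metis

lemma is_strong_sum_compose:
  assumes "is_strong_sum I t s"
  shows "is_strong_sum I (\<lambda>i. a o\<^sub>L t i o\<^sub>L b) (a o\<^sub>L s o\<^sub>L b)"
  using assms unfolding is_strong_sum_def
  by (auto intro: has_sum_bounded_linear[OF blinfun.bounded_linear_right])

lemma is_strong_sum_scaleC:
  assumes "is_strong_sum I t s" and "\<And>i c v. i \<in> I \<Longrightarrow> t i (c *\<^sub>C v) = c *\<^sub>C t i v"
  shows "s (c *\<^sub>C v) = c *\<^sub>C s v"
proof (rule has_sum_unique)
  show "((\<lambda>i. t i (c *\<^sub>C v)) has_sum s (c *\<^sub>C v)) I"
    using assms(1) unfolding is_strong_sum_def by blast
  have "((\<lambda>i. c *\<^sub>C t i v) has_sum c *\<^sub>C s v) I"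
    using assms(1) unfolding is_strong_sum_def
    by (intro has_sum_bounded_linear[OF bounded_linear_scaleC]) blast
  then show "((\<lambda>i. t i (c *\<^sub>C v)) has_sum c *\<^sub>C s v) I"
    by (rule has_sum_cong[THEN iffD2, rotated]) (simp add: assms(2))
qed

text \<open>Both the ranges and the initial spaces of the blocks are orthogonal, so the norm of the
  sum is controlled by the largest block and not by the number of blocks. Keeping the same constant
  \<open>C\<close> is what later carries \<epsilon> from the blocks to their sum.\<close>

lemma strong_sum_of_blocks:
  fixes P t :: "'i \<Rightarrow> 'h::chilbert_space \<Rightarrow>\<^sub>L 'h"
  assumes proj: "\<And>i. i \<in> I \<Longrightarrow> projection (P i)"
    and orth: "\<And>i j. \<lbrakk>i \<in> I; j \<in> I; i \<noteq> j\<rbrakk> \<Longrightarrow> P i o\<^sub>L P j = 0"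
    and left: "\<And>i. i \<in> I \<Longrightarrow> P i o\<^sub>L t i = t i"
    and right: "\<And>i. i \<in> I \<Longrightarrow> t i o\<^sub>L P i = t i"
    and bound: "\<And>i. i \<in> I \<Longrightarrow> norm (t i) \<le> C"
    and "0 \<le> C"
  obtains s where "is_strong_sum I t s" and "norm s \<le> C"
proof -
  have squares: "(\<Sum>i\<in>F. (norm (t i v))\<^sup>2) \<le> (C * norm v)\<^sup>2" if "finite F" "F \<subseteq> I" for F v
  proof -
    have "norm (t i v) \<le> C * norm (P i v)" if "i \<in> F" for i
    proof -
      \<comment> \<open>The block sees only its own component of \<open>v\<close>; this replaces
        \<open>norm v\<close> by \<open>norm (P i v)\<close>, whose squares Bessel's inequality can
        sum.\<close>
      have "t i v = t i (P i v)"
        using right \<open>F \<subseteq> I\<close> that by (metis blinfun_apply_blinfun_compose subsetD)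
      then show ?thesis
        using bound \<open>F \<subseteq> I\<close> that
        by (metis mult_right_mono norm_blinfun norm_ge_zero order_trans subsetD)
    qed
    then have "(\<Sum>i\<in>F. (norm (t i v))\<^sup>2) \<le> (\<Sum>i\<in>F. C\<^sup>2 * (norm (P i v))\<^sup>2)"
      by (intro sum_mono) (simp add: power_mono flip: power_mult_distrib)
    also have "\<dots> = C\<^sup>2 * (\<Sum>i\<in>F. (norm (P i v))\<^sup>2)"
      by (simp add: sum_distrib_left)
    also have "\<dots> \<le> C\<^sup>2 * (norm v)\<^sup>2"
      using that by (intro mult_left_mono bessel_inequality proj orth) auto
    finally show ?thesis
      by (simp add: power_mult_distrib)
  qed
  have orthogonal: "cinner (t i v) (t j v) = 0" if "i \<in> I" "j \<in> I" "i \<noteq> j" for i j v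
  proof -
    have "cinner (t i v) (t j v) = cinner (P i (t i v)) (P j (t j v))"
      using left that by (metis blinfun_apply_blinfun_compose)
    also have "\<dots> = cinner (t i v) ((P i o\<^sub>L P j) (t j v))"
      using proj that by (simp add: projection_cinner)
    finally show ?thesis
      using orth that by simp
  qed
  have sums: "((\<lambda>i. t i v) has_sum (\<Sum>\<^sub>\<infinity>i\<in>I. t i v)) I" for v
    using summable_on_orthogonal[of I "\<lambda>i. t i v", OF orthogonal squares] by simp
  have bounded: "norm (\<Sum>\<^sub>\<infinity>i\<in>I. t i v) \<le> C * norm v" for v
  proof (rule tendsto_upperbound)
    show "((\<lambda>F. norm (\<Sum>i\<in>F. t i v)) \<longlongrightarrow> norm (\<Sum>\<^sub>\<infinity>i\<in>I. t i v)) (finite_subsets_at_top I)"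
      using sums[of v] unfolding has_sum_def by (rule tendsto_norm)
    have "norm (\<Sum>i\<in>F. t i v) \<le> C * norm v" if "finite F" "F \<subseteq> I" for F
    proof (rule power2_le_imp_le)
      have "(norm (\<Sum>i\<in>F. t i v))\<^sup>2 = (\<Sum>i\<in>F. (norm (t i v))\<^sup>2)"
        using that by (intro norm_sum_orthogonal orthogonal) auto
      then show "(norm (\<Sum>i\<in>F. t i v))\<^sup>2 \<le> (C * norm v)\<^sup>2"
        using squares that by simp
    qed (simp add: \<open>0 \<le> C\<close>)
    then show "\<forall>\<^sub>F F in finite_subsets_at_top I. norm (\<Sum>i\<in>F. t i v) \<le> C * norm v"
      by (intro eventually_finite_subsets_at_top_weakI)
  qed simp
  have linear: "bounded_linear (\<lambda>v. \<Sum>\<^sub>\<infinity>i\<in>I. t i v)"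
  proof (rule bounded_linear_intro[where K = C])
    fix r :: real and v w
    show "(\<Sum>\<^sub>\<infinity>i\<in>I. t i (v + w)) = (\<Sum>\<^sub>\<infinity>i\<in>I. t i v) + (\<Sum>\<^sub>\<infinity>i\<in>I. t i w)"
      using has_sum_add[OF sums sums] by (intro infsumI) (simp add: blinfun.add_right)
    show "(\<Sum>\<^sub>\<infinity>i\<in>I. t i (r *\<^sub>R v)) = r *\<^sub>R (\<Sum>\<^sub>\<infinity>i\<in>I. t i v)"
      using has_sum_bounded_linear[OF bounded_linear_scaleR_right sums]
      by (intro infsumI) (simp add: blinfun.scaleR_right)
  qed (metis bounded mult.commute)
  define s where "s = Blinfun (\<lambda>v. \<Sum>\<^sub>\<infinity>i\<in>I. t i v)"
  have s: "s v = (\<Sum>\<^sub>\<infinity>i\<in>I. t i v)" for v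
    unfolding s_def by (simp add: bounded_linear_Blinfun_apply linear)
  show thesis
  proof
    show "is_strong_sum I t s"
      unfolding is_strong_sum_def s using sums by blast
    show "norm s \<le> C"
      using bounded \<open>0 \<le> C\<close> by (intro norm_blinfun_bound) (simp_all add: s)
  qed
qed

section \<open>Coarse structures and supports\<close>

text \<open>Serves two degenerate cases of local compactness: the empty bounded set, and the zero
  corners of an operator living on another component.\<close>

lemma compact_operator_zero [simp]: "compact_operator 0"
proof -
  have "blinfun_apply (0 :: 'a \<Rightarrow>\<^sub>L 'a) ` cball 0 1 = {0}"
    by (auto intro!: image_eqI[of _ _ 0])
  then show ?thesis
    by (simp add: compact_operator_def)
qed

lemma supp_in_iff_quasi_local_at: "supp_in M t E \<longleftrightarrow> quasi_local_at M t 0 E"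
  by (simp add: supp_in_def quasi_local_at_def)

lemma blinfun_eq_iff: "s = t \<longleftrightarrow> (\<forall>v. blinfun_apply s v = blinfun_apply t v)"
  by (auto intro: blinfun_eqI)

lemma separated_mono: "\<lbrakk>separated E B A; B' \<subseteq> B; A' \<subseteq> A\<rbrakk> \<Longrightarrow> separated E B' A'"
  unfolding separated_def thicken_def by blast

text \<open>Separation of two subsets of \<open>Y\<close> tests only those pairs of \<open>E\<close>
  that lie in \<open>Y \<times> Y\<close>.\<close>

lemma quasi_local_at_module_restrict_Int:
  "quasi_local_at (module_restrict M Y) t \<epsilon> (E \<inter> Y \<times> Y) \<longleftrightarrow>
    quasi_local_at (module_restrict M Y) t \<epsilon> E"
proof -
  have "separated (E \<inter> Y \<times> Y) B A \<longleftrightarrow> separated E B A" if "B \<subseteq> Y" "A \<subseteq> Y" for A B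
    using that unfolding separated_def thicken_def by blast
  then show ?thesis
    unfolding quasi_local_at_def module_restrict_def by auto
qed

text \<open>The algebras of a component quantify over restricted entourages, the families over
  entourages of the whole space; this makes the two interchangeable.\<close>

lemma ex_entourage_coarse_restrict:
  "(\<exists>F\<in>entourages (coarse_restrict \<X> Y). quasi_local_at (module_restrict M Y) t \<epsilon> F) \<longleftrightarrow>
    (\<exists>E\<in>entourages \<X>. quasi_local_at (module_restrict M Y) t \<epsilon> E)"
  by (simp add: coarse_restrict_def quasi_local_at_module_restrict_Int)

text \<open>Applied to compression, which retracts an algebra onto that of a component, this carries
  the equality of corners over to norm closures.\<close>

lemma image_closure_retraction:
  fixes f :: "'a::t2_space \<Rightarrow> 'a"
  assumes "continuous_on UNIV f" and "f ` R \<subseteq> S" and "S \<subseteq> R" and "\<And>s. s \<in> S \<Longrightarrow> f s = s"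
  shows "f ` closure R = closure S"
proof
  have "f ` closure R \<subseteq> closure (f ` R)"
    using assms(1) by (intro image_closure_subset continuous_on_subset[OF assms(1)])
      (auto intro: subsetD[OF closure_subset])
  then show "f ` closure R \<subseteq> closure S"
    using closure_mono[OF assms(2)] by blast
  \<comment> \<open>The fixed points form a closed set containing \<open>S\<close>, so every point
    of \<open>closure S\<close> is its own preimage.\<close>
  have "closed {s. f s = s}"
    using assms(1) by (intro closed_Collect_eq) (auto intro: continuous_intros)
  then have fixed: "closure S \<subseteq> {s. f s = s}"
    using assms(4) by (intro closure_minimal) auto
  show "closure S \<subseteq> f ` closure R"
  proof
    fix s
    assume "s \<in> closure S"
    then have "s = f s" "s \<in> closure R"
      using fixed closure_mono[OF assms(3)] by auto
    then show "s \<in> f ` closure R"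
      by (rule image_eqI)
  qed
qed

section \<open>Entourages, bounded sets and components\<close>

locale coarse_decomposition =
  fixes \<X> :: "'x coarse"
    and M :: "('x, 'h::chilbert_space) cmodule"
    and I :: "'i set"
    and X :: "'i \<Rightarrow> 'x set"
  assumes coarse: "coarse_space \<X>"
    and components: "coarse_components \<X> I X"
    and module: "coarse_module \<X> M"
    and component_meas: "\<And>i. i \<in> I \<Longrightarrow> X i \<in> meas M"
begin

abbreviation P :: "'i \<Rightarrow> 'h \<Rightarrow>\<^sub>L 'h" where
  "P i \<equiv> proj M (X i)"

abbreviation compress :: "'i \<Rightarrow> ('h \<Rightarrow>\<^sub>L 'h) \<Rightarrow> ('h \<Rightarrow>\<^sub>L 'h)" where
  "compress i t \<equiv> P i o\<^sub>L t o\<^sub>L P i"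

lemma entourage_subset: "E \<in> entourages \<X> \<Longrightarrow> E \<subseteq> points \<X> \<times> points \<X>"
  and entourage_mono: "\<lbrakk>E \<in> entourages \<X>; F \<subseteq> E\<rbrakk> \<Longrightarrow> F \<in> entourages \<X>"
  and entourage_Un: "\<lbrakk>E \<in> entourages \<X>; F \<in> entourages \<X>\<rbrakk> \<Longrightarrow> E \<union> F \<in> entourages \<X>"
  and entourage_Id_on: "Id_on (points \<X>) \<in> entourages \<X>"
  and entourage_converse: "E \<in> entourages \<X> \<Longrightarrow> E\<inverse> \<in> entourages \<X>"
  using coarse unfolding coarse_space_def by (simp_all add: subset_iff)

lemma points_cover:
  assumes "x \<in> points \<X>"
  obtains i where "i \<in> I" and "x \<in> X i"
proof -
  have "x \<in> (\<Union>i\<in>I. X i)"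
    using assms components unfolding coarse_components_def by simp
  then show thesis
    using that by blast
qed

lemma entourage_within_component:
  assumes E: "E \<in> entourages \<X>" "(x, y) \<in> E" and "i \<in> I"
  shows "x \<in> X i \<longleftrightarrow> y \<in> X i"
proof -
  have pts: "x \<in> points \<X>" "y \<in> points \<X>"
    using entourage_subset[OF E(1)] E(2) by blast+
  \<comment> \<open>The converse and the diagonal are added so that all four pairs formed from
    \<open>x\<close> and \<open>y\<close> are covered.\<close>
  have "E \<union> E\<inverse> \<union> Id_on (points \<X>) \<in> entourages \<X>"
    using E by (intro entourage_Un entourage_converse entourage_Id_on)
  moreover have "{x, y} \<times> {x, y} \<subseteq> E \<union> E\<inverse> \<union> Id_on (points \<X>)"
    using E pts by auto
  ultimately have "coarsely_bounded \<X> {x, y}"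
    unfolding coarsely_bounded_def by (rule entourage_mono)
  \<comment> \<open>The bounded set \<open>{x, y}\<close> meets both components, which coarse
    disjointness allows only if they coincide.\<close>
  then have same: "j = k" if "j \<in> I" "k \<in> I" "x \<in> X j" "y \<in> X k" for j k
    using that components unfolding coarse_components_def coarsely_disjoint_def by blast
  obtain j k where "j \<in> I" "k \<in> I" "x \<in> X j" "y \<in> X k"
    using pts points_cover by metis
  then show ?thesis
    using same \<open>i \<in> I\<close> by metis
qed

text \<open>The entourage \<open>A \<times> A\<close> relates one chosen point of \<open>A\<close>
  to all others, so they share its component. Non-emptiness supplies that point and thereby the
  index.\<close>

lemma bounded_within_component:
  assumes "coarsely_bounded \<X> A" and "A \<noteq> {}"
  obtains i where "i \<in> I" and "A \<subseteq> X i"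
proof -
  obtain a where "a \<in> A"
    using assms by blast
  then have "a \<in> points \<X>"
    using assms(1) entourage_subset unfolding coarsely_bounded_def by blast
  then obtain i where i: "i \<in> I" "a \<in> X i"
    by (rule points_cover)
  have "A \<subseteq> X i"
  proof
    fix b
    assume "b \<in> A"
    then show "b \<in> X i"
      using entourage_within_component[of "A \<times> A" a b i] assms(1) \<open>a \<in> A\<close> i
      unfolding coarsely_bounded_def by simp
  qed
  with i(1) show thesis
    by (rule that)
qed

lemma coarsely_bounded_coarse_restrict:
  assumes "A \<subseteq> Y"
  shows "coarsely_bounded (coarse_restrict \<X> Y) A \<longleftrightarrow> coarsely_bounded \<X> A"
proof
  assume "coarsely_bounded (coarse_restrict \<X> Y) A"
  then obtain E where "E \<in> entourages \<X>" "A \<times> A \<subseteq> E"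
    unfolding coarsely_bounded_def coarse_restrict_def by auto
  then show "coarsely_bounded \<X> A"
    unfolding coarsely_bounded_def using entourage_mono by blast
next
  assume "coarsely_bounded \<X> A"
  moreover have "A \<times> A = A \<times> A \<inter> Y \<times> Y"
    using assms by blast
  ultimately show "coarsely_bounded (coarse_restrict \<X> Y) A"
    unfolding coarsely_bounded_def coarse_restrict_def by auto
qed

section \<open>Measurable sets, their projections, and operators on the blocks\<close>

lemma algebra_meas: "algebra (points \<X>) (meas M)"
  using module unfolding coarse_module_def by blast

lemma meas_subset: "A \<in> meas M \<Longrightarrow> A \<subseteq> points \<X>"
  and meas_points: "points \<X> \<in> meas M"
  and meas_Int: "\<lbrakk>A \<in> meas M; B \<in> meas M\<rbrakk> \<Longrightarrow> A \<inter> B \<in> meas M"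
  and meas_compl: "A \<in> meas M \<Longrightarrow> points \<X> - A \<in> meas M"
proof -
  interpret algebra "points \<X>" "meas M"
    by (rule algebra_meas)
  show "A \<in> meas M \<Longrightarrow> A \<subseteq> points \<X>"
    by (rule sets_into_space)
  show "points \<X> \<in> meas M"
    by (rule top)
  show "\<lbrakk>A \<in> meas M; B \<in> meas M\<rbrakk> \<Longrightarrow> A \<inter> B \<in> meas M"
    by (rule Int)
  show "A \<in> meas M \<Longrightarrow> points \<X> - A \<in> meas M"
    by (rule compl_sets)
qed

lemma projection_proj: "A \<in> meas M \<Longrightarrow> projection (proj M A)"
  and proj_empty [simp]: "proj M {} = 0"
  and proj_Int: "\<lbrakk>A \<in> meas M; B \<in> meas M\<rbrakk> \<Longrightarrow> proj M (A \<inter> B) = proj M A o\<^sub>L proj M B"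
  using module unfolding coarse_module_def by blast+

lemma proj_proj: "\<lbrakk>A \<in> meas M; B \<in> meas M\<rbrakk> \<Longrightarrow> proj M A (proj M B v) = proj M (A \<inter> B) v"
  by (simp add: proj_Int)

lemma proj_scaleC: "A \<in> meas M \<Longrightarrow> proj M A (c *\<^sub>C v) = c *\<^sub>C proj M A v"
  using module unfolding coarse_module_def operators_on_def by blast

text \<open>Presents the module's Hilbert space as the range of a projection, so that
  \<open>operators_on_range_iff\<close> describes its operators.\<close>

lemma hilb_eq_range: "hilb M = range (proj M (points \<X>))"
proof -
  have "proj M (points \<X>) v \<in> hilb M" for v
    using module meas_points unfolding coarse_module_def operators_on_def by blast
  moreover have "v = proj M (points \<X>) v" if "v \<in> hilb M" for v
    using module that unfolding coarse_module_def by simp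
  ultimately show ?thesis
    by blast
qed

lemma hilb_component_eq_range:
  assumes "i \<in> I"
  shows "hilb (module_restrict M (X i)) = range (P i)"
proof -
  \<comment> \<open>\<open>P i\<close> absorbs the projection onto \<open>hilb M\<close>, so its
    image of \<open>hilb M\<close> is already its full range in the ambient space.\<close>
  have "P i v = P i (proj M (points \<X>) v)" for v
    using component_meas[OF assms] meas_subset[of "X i"]
    by (simp add: proj_proj meas_points Int_absorb2)
  then show ?thesis
    unfolding module_restrict_def hilb_eq_range by auto
qed

lemma operators_on_hilb_iff:
  "t \<in> operators_on (hilb M) \<longleftrightarrow> (\<forall>c v. t (c *\<^sub>C v) = c *\<^sub>C t v) \<and>
    (\<forall>v. proj M (points \<X>) (t v) = t v) \<and> (\<forall>v. t (proj M (points \<X>) v) = t v)"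
  unfolding hilb_eq_range operators_on_range_iff[OF projection_proj[OF meas_points]]
  by (auto simp: blinfun_eq_iff)

lemma operators_on_component_iff:
  assumes "i \<in> I"
  shows "t \<in> operators_on (hilb (module_restrict M (X i))) \<longleftrightarrow>
    (\<forall>c v. t (c *\<^sub>C v) = c *\<^sub>C t v) \<and> (\<forall>v. P i (t v) = t v) \<and> (\<forall>v. t (P i v) = t v)"
  unfolding hilb_component_eq_range[OF assms]
    operators_on_range_iff[OF projection_proj[OF component_meas[OF assms]]]
  by (auto simp: blinfun_eq_iff)

lemma components_disjoint: "\<lbrakk>i \<in> I; j \<in> I; i \<noteq> j\<rbrakk> \<Longrightarrow> X i \<inter> X j = {}"
  using components unfolding coarse_components_def disjoint_family_on_def by blast

lemma P_P: "\<lbrakk>i \<in> I; j \<in> I\<rbrakk> \<Longrightarrow> P i (P j v) = (if i = j then P i v else 0)"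
  by (simp add: proj_proj component_meas components_disjoint)

lemma operators_on_component_subset:
  assumes "i \<in> I" and "t \<in> operators_on (hilb (module_restrict M (X i)))"
  shows "t \<in> operators_on (hilb M)"
proof -
  have "proj M (points \<X>) (P i v) = P i v" "P i (proj M (points \<X>) v) = P i v" for v
    using component_meas[OF assms(1)] meas_subset[of "X i"]
    by (simp_all add: proj_proj meas_points Int_absorb1 Int_absorb2)
  then show ?thesis
    using assms unfolding operators_on_hilb_iff operators_on_component_iff[OF assms(1)] by metis
qed

lemma compress_operators_on:
  assumes "i \<in> I" and "t \<in> operators_on (hilb M)"
  shows "compress i t \<in> operators_on (hilb (module_restrict M (X i)))"
  using assms unfolding operators_on_component_iff[OF assms(1)]
  by (simp add: operators_on_hilb_iff component_meas proj_scaleC P_P)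

lemma compress_component:
  assumes "i \<in> I" and "j \<in> I" and "t \<in> operators_on (hilb (module_restrict M (X i)))"
  shows "compress j t = (if j = i then t else 0)"
proof (rule blinfun_eqI)
  fix v
  \<comment> \<open>An operator on block \<open>i\<close> absorbs \<open>P i\<close> on both sides,
    which brings \<open>P i\<close> next to \<open>P j\<close>.\<close>
  have "compress j t v = P j (P i (t (P i (P j v))))"
    using assms unfolding operators_on_component_iff[OF assms(1)] by simp
  then show "compress j t v = (if j = i then t else 0) v"
    using assms operators_on_component_iff[OF assms(1)] by (simp add: P_P blinfun.zero_right)
qed

lemma separated_component:
  assumes "E \<in> entourages \<X>" and "i \<in> I"
  shows "separated E (X i) (points \<X> - X i)" and "separated E (points \<X> - X i) (X i)"
  using entourage_within_component[OF assms(1) _ assms(2)]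
  unfolding separated_def thicken_def by blast+

section \<open>Quasi-local operators are block diagonal\<close>

text \<open>Block diagonality is encoded as commutation with the component projections, which is
  what quasi-locality yields directly. That such an operator is the strong sum of its corners is a
  separate fact, \<open>block_diagonal_decompose\<close>.\<close>

definition block_diagonal :: "('h \<Rightarrow>\<^sub>L 'h) \<Rightarrow> bool" where
  "block_diagonal t \<longleftrightarrow> t \<in> operators_on (hilb M) \<and> (\<forall>i\<in>I. P i o\<^sub>L t = t o\<^sub>L P i)"

lemma block_diagonal_commute:
  "\<lbrakk>block_diagonal t; i \<in> I\<rbrakk> \<Longrightarrow> t (P i v) = P i (t v)"
  unfolding block_diagonal_def by (metis blinfun_apply_blinfun_compose)

lemma proj_points_split:
  assumes "A \<in> meas M"
  shows "proj M (points \<X>) v = proj M A v + proj M (points \<X> - A) v"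
proof -
  have "proj M (A \<union> (points \<X> - A)) =
      proj M A + proj M (points \<X> - A) - (proj M A o\<^sub>L proj M (points \<X> - A))"
    using module assms meas_compl[OF assms] unfolding coarse_module_def by blast
  moreover have "A \<union> (points \<X> - A) = points \<X>" "A \<inter> (points \<X> - A) = {}"
    using meas_subset[OF assms] by auto
  ultimately have "proj M (points \<X>) = proj M A + proj M (points \<X> - A)"
    using proj_Int[OF assms meas_compl[OF assms]] by simp
  then show ?thesis
    by (simp add: blinfun.add_left)
qed

text \<open>The entourage supplied by quasi-locality varies with \<epsilon>; separation by all
  entourages lets every \<epsilon> bound the same corner.\<close>

lemma quasi_local_vanishes:
  assumes "t \<in> ql_Cstar \<X> M" and "B \<in> meas M" and "A \<in> meas M"
    and "\<And>E. E \<in> entourages \<X> \<Longrightarrow> separated E B A"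
  shows "proj M B (t (proj M A v)) = 0"
proof -
  have "norm (proj M B o\<^sub>L t o\<^sub>L proj M A) \<le> \<epsilon>" if "\<epsilon> > 0" for \<epsilon>
    using assms that unfolding ql_Cstar_def quasi_local_at_def by blast
  then have "norm (proj M B o\<^sub>L t o\<^sub>L proj M A) \<le> 0"
    by (rule field_le_epsilon) simp
  then have "(proj M B o\<^sub>L t o\<^sub>L proj M A) v = 0"
    by simp
  then show ?thesis
    by simp
qed

lemma quasi_local_imp_block_diagonal:
  assumes t: "t \<in> ql_Cstar \<X> M"
  shows "block_diagonal t"
  unfolding block_diagonal_def
proof (intro conjI ballI blinfun_eqI)
  show ops: "t \<in> operators_on (hilb M)"
    using t unfolding ql_Cstar_def by blast
  fix i v
  assume i: "i \<in> I"
  let ?Q = "proj M (points \<X> - X i)"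
  note meas = component_meas[OF i] meas_compl[OF component_meas[OF i]]
  \<comment> \<open>The input is split along the component and its complement, and one off-diagonal
    corner drops out. The output is then split in the same way, with the other off-diagonal corner
    added as zero.\<close>
  have "P i (t v) = P i (t (P i v + ?Q v))"
    using ops unfolding operators_on_hilb_iff proj_points_split[OF meas(1)] by metis
  also have "\<dots> = P i (t (P i v))"
    using quasi_local_vanishes[OF t meas separated_component(1)[OF _ i]]
    by (simp add: blinfun.add_right)
  also have "\<dots> = P i (t (P i v)) + ?Q (t (P i v))"
    using quasi_local_vanishes[OF t meas(2,1) separated_component(2)[OF _ i]] by simp
  also have "\<dots> = t (P i v)"
    using ops unfolding operators_on_hilb_iff proj_points_split[OF meas(1)] by metis
  finally show "(P i o\<^sub>L t) v = (t o\<^sub>L P i) v"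
    by simp
qed

lemma cp_alg_subset_ql_Cstar: "cp_alg \<X> M \<subseteq> ql_Cstar \<X> M"
proof
  fix t
  assume "t \<in> cp_alg \<X> M"
  then obtain E where "t \<in> operators_on (hilb M)" "E \<in> entourages \<X>" "quasi_local_at M t 0 E"
    unfolding cp_alg_def supp_in_iff_quasi_local_at by blast
  moreover from this have "quasi_local_at M t \<epsilon> E" if "\<epsilon> > 0" for \<epsilon>
    using that unfolding quasi_local_at_def by force
  ultimately show "t \<in> ql_Cstar \<X> M"
    unfolding ql_Cstar_def by blast
qed

section \<open>Localisation to a component\<close>

text \<open>Projections of measurable subsets of \<open>X i\<close> absorb \<open>P i\<close>, so
  compression leaves the tested corners unchanged.\<close>

lemma quasi_local_at_compress:
  assumes "quasi_local_at M t \<epsilon> E" and "i \<in> I"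
  shows "quasi_local_at (module_restrict M (X i)) (compress i t) \<epsilon> E"
proof -
  have "proj M B o\<^sub>L compress i t o\<^sub>L proj M A = proj M B o\<^sub>L t o\<^sub>L proj M A"
    if "A \<in> meas M" "B \<in> meas M" "A \<subseteq> X i" "B \<subseteq> X i" for A B
    using that assms(2)
    by (intro blinfun_eqI) (simp add: proj_proj component_meas Int_absorb1 Int_absorb2)
  then show ?thesis
    using assms(1) unfolding quasi_local_at_def module_restrict_def by simp
qed

text \<open>As \<open>t\<close> absorbs \<open>P i\<close> on both sides, the test sets may be cut
  down to \<open>X i\<close>, and shrinking them preserves separation.\<close>

lemma quasi_local_at_extend:
  assumes "quasi_local_at (module_restrict M (X i)) t \<epsilon> E" and i: "i \<in> I"
    and t: "t \<in> operators_on (hilb (module_restrict M (X i)))"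
  shows "quasi_local_at M t \<epsilon> E"
  unfolding quasi_local_at_def
proof (intro ballI impI)
  fix B A
  assume BA: "B \<in> meas M" "A \<in> meas M" "separated E B A"
  note meas = component_meas[OF i]
  have "proj M B (t (proj M A v)) = proj M B (P i (t (P i (proj M A v))))" for v
    using t unfolding operators_on_component_iff[OF i] by metis
  then have "proj M B o\<^sub>L t o\<^sub>L proj M A = proj M (B \<inter> X i) o\<^sub>L t o\<^sub>L proj M (X i \<inter> A)"
    using BA by (intro blinfun_eqI) (simp add: proj_proj meas)
  moreover have "separated E (B \<inter> X i) (X i \<inter> A)"
    using BA(3) by (rule separated_mono) auto
  ultimately show "norm (proj M B o\<^sub>L t o\<^sub>L proj M A) \<le> \<epsilon>"
    using assms(1) BA meas unfolding quasi_local_at_def module_restrict_def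
    by (simp add: meas_Int)
qed

text \<open>A non-empty bounded set lies in a single component, and there the operator and its
  corner have the same products with the projection of that set.\<close>

lemma locally_compact_block_diagonal_iff:
  assumes t: "block_diagonal t"
  shows "locally_compact_operator \<X> M t \<longleftrightarrow> (\<forall>i\<in>I.
    locally_compact_operator (coarse_restrict \<X> (X i)) (module_restrict M (X i)) (compress i t))"
    (is "?L \<longleftrightarrow> ?R")
proof -
  have eq: "proj M A o\<^sub>L compress i t = proj M A o\<^sub>L t" "compress i t o\<^sub>L proj M A = t o\<^sub>L proj M A"
    if "i \<in> I" "A \<in> meas M" "A \<subseteq> X i" for i A
    using that
    \<comment> \<open>In the first identity a remaining \<open>P i\<close> must move left through
      \<open>t\<close> to reach \<open>proj M A\<close>; in the second it moves right. Hence
      commutation is used in both orientations.\<close>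
    by (auto intro!: blinfun_eqI simp: proj_proj component_meas Int_absorb1 Int_absorb2
        block_diagonal_commute[OF t, symmetric])
       (simp_all add: block_diagonal_commute[OF t] proj_proj component_meas Int_absorb1 Int_absorb2)
  show ?thesis
  proof
    assume ?L
    then show ?R
      unfolding locally_compact_operator_def module_restrict_def
      by (auto simp: eq coarsely_bounded_coarse_restrict)
  next
    assume R: ?R
    show ?L
      unfolding locally_compact_operator_def
    proof (intro ballI impI)
      fix A
      assume A: "A \<in> meas M" "coarsely_bounded \<X> A"
      show "compact_operator (proj M A o\<^sub>L t) \<and> compact_operator (t o\<^sub>L proj M A)"
      proof (cases "A = {}")
        case False
        then obtain i where i: "i \<in> I" "A \<subseteq> X i"
          using A bounded_within_component by blast
        then have "compact_operator (proj M A o\<^sub>L compress i t) \<and>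
            compact_operator (compress i t o\<^sub>L proj M A)"
          using R A unfolding locally_compact_operator_def module_restrict_def
          by (simp add: coarsely_bounded_coarse_restrict)
        then show ?thesis
          using eq i A by simp
      qed simp
    qed
  qed
qed

lemma cp_alg_component_iff:
  assumes "i \<in> I"
  shows "t \<in> cp_alg (coarse_restrict \<X> (X i)) (module_restrict M (X i)) \<longleftrightarrow>
    t \<in> operators_on (hilb (module_restrict M (X i))) \<and>
    (\<exists>E\<in>entourages \<X>. quasi_local_at (module_restrict M (X i)) t 0 E)"
  unfolding cp_alg_def supp_in_iff_quasi_local_at
  by (simp add: ex_entourage_coarse_restrict)

lemma ql_Cstar_component_iff:
  assumes "i \<in> I"
  shows "t \<in> ql_Cstar (coarse_restrict \<X> (X i)) (module_restrict M (X i)) \<longleftrightarrow>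
    t \<in> operators_on (hilb (module_restrict M (X i))) \<and>
    (\<forall>\<epsilon>>0. \<exists>E\<in>entourages \<X>. quasi_local_at (module_restrict M (X i)) t \<epsilon> E)"
  unfolding ql_Cstar_def by (simp add: ex_entourage_coarse_restrict)

lemma component_subset:
  assumes i: "i \<in> I"
  shows "cp_alg (coarse_restrict \<X> (X i)) (module_restrict M (X i)) \<subseteq> cp_alg \<X> M"
    and "ql_Cstar (coarse_restrict \<X> (X i)) (module_restrict M (X i)) \<subseteq> ql_Cstar \<X> M"
    and "Roe_alg (coarse_restrict \<X> (X i)) (module_restrict M (X i)) \<subseteq> Roe_alg \<X> M"
proof -
  show cp: "cp_alg (coarse_restrict \<X> (X i)) (module_restrict M (X i)) \<subseteq> cp_alg \<X> M"
  proof
    fix t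
    assume "t \<in> cp_alg (coarse_restrict \<X> (X i)) (module_restrict M (X i))"
    then have ops: "t \<in> operators_on (hilb (module_restrict M (X i)))"
      and "\<exists>E\<in>entourages \<X>. quasi_local_at (module_restrict M (X i)) t 0 E"
      by (simp_all add: cp_alg_component_iff[OF i])
    then have "\<exists>E\<in>entourages \<X>. quasi_local_at M t 0 E"
      using quasi_local_at_extend[OF _ i ops] by blast
    then show "t \<in> cp_alg \<X> M"
      using operators_on_component_subset[OF i ops]
      unfolding cp_alg_def supp_in_iff_quasi_local_at by simp
  qed
  show "ql_Cstar (coarse_restrict \<X> (X i)) (module_restrict M (X i)) \<subseteq> ql_Cstar \<X> M"
  proof
    fix t
    assume "t \<in> ql_Cstar (coarse_restrict \<X> (X i)) (module_restrict M (X i))"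
    then have ops: "t \<in> operators_on (hilb (module_restrict M (X i)))"
      and "\<forall>\<epsilon>>0. \<exists>E\<in>entourages \<X>. quasi_local_at (module_restrict M (X i)) t \<epsilon> E"
      by (simp_all add: ql_Cstar_component_iff[OF i])
    then have "\<forall>\<epsilon>>0. \<exists>E\<in>entourages \<X>. quasi_local_at M t \<epsilon> E"
      using quasi_local_at_extend[OF _ i ops] by meson
    then show "t \<in> ql_Cstar \<X> M"
      using operators_on_component_subset[OF i ops] unfolding ql_Cstar_def by simp
  qed
  show "Roe_alg (coarse_restrict \<X> (X i)) (module_restrict M (X i)) \<subseteq> Roe_alg \<X> M"
  proof
    fix t
    assume "t \<in> Roe_alg (coarse_restrict \<X> (X i)) (module_restrict M (X i))"
    then have cp_t: "t \<in> cp_alg (coarse_restrict \<X> (X i)) (module_restrict M (X i))"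
      and lc: "locally_compact_operator (coarse_restrict \<X> (X i)) (module_restrict M (X i)) t"
      unfolding Roe_alg_def by simp_all
    \<comment> \<open>All corners at other components vanish, so local compactness has content only
      on component \<open>i\<close>.\<close>
    have "compress j t = (if j = i then t else 0)" if "j \<in> I" for j
      using cp_t unfolding cp_alg_component_iff[OF i] by (intro compress_component[OF i that]) simp
    then have "\<forall>j\<in>I. locally_compact_operator (coarse_restrict \<X> (X j))
        (module_restrict M (X j)) (compress j t)"
      using lc by (simp add: locally_compact_operator_def)
    moreover have "block_diagonal t"
      using cp cp_t cp_alg_subset_ql_Cstar quasi_local_imp_block_diagonal by blast
    ultimately have "locally_compact_operator \<X> M t"
      by (simp add: locally_compact_block_diagonal_iff)
    then show "t \<in> Roe_alg \<X> M"
      using cp cp_t unfolding Roe_alg_def by blast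
  qed
qed

text \<open>Corners inherit the entourages of the operator. For the Roe algebra, controlled
  propagation first gives block diagonality, which makes local compactness a blockwise
  condition.\<close>

lemma compress_into_component:
  assumes i: "i \<in> I"
  shows "compress i ` cp_alg \<X> M \<subseteq> cp_alg (coarse_restrict \<X> (X i)) (module_restrict M (X i))"
    and "compress i ` ql_Cstar \<X> M \<subseteq> ql_Cstar (coarse_restrict \<X> (X i)) (module_restrict M (X i))"
    and "compress i ` Roe_alg \<X> M \<subseteq> Roe_alg (coarse_restrict \<X> (X i)) (module_restrict M (X i))"
proof -
  show cp: "compress i ` cp_alg \<X> M \<subseteq> cp_alg (coarse_restrict \<X> (X i)) (module_restrict M (X i))"
  proof (rule image_subsetI)
    fix t
    assume "t \<in> cp_alg \<X> M"
    then have "t \<in> operators_on (hilb M)" "\<exists>E\<in>entourages \<X>. quasi_local_at M t 0 E"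
      unfolding cp_alg_def supp_in_iff_quasi_local_at by simp_all
    then show "compress i t \<in> cp_alg (coarse_restrict \<X> (X i)) (module_restrict M (X i))"
      unfolding cp_alg_component_iff[OF i]
      using quasi_local_at_compress[OF _ i] compress_operators_on[OF i] by meson
  qed
  show "compress i ` ql_Cstar \<X> M \<subseteq> ql_Cstar (coarse_restrict \<X> (X i)) (module_restrict M (X i))"
  proof (rule image_subsetI)
    fix t
    assume "t \<in> ql_Cstar \<X> M"
    then have "t \<in> operators_on (hilb M)" "\<forall>\<epsilon>>0. \<exists>E\<in>entourages \<X>. quasi_local_at M t \<epsilon> E"
      unfolding ql_Cstar_def by simp_all
    then show "compress i t \<in> ql_Cstar (coarse_restrict \<X> (X i)) (module_restrict M (X i))"
      unfolding ql_Cstar_component_iff[OF i]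
      using quasi_local_at_compress[OF _ i] compress_operators_on[OF i] by meson
  qed
  show "compress i ` Roe_alg \<X> M \<subseteq> Roe_alg (coarse_restrict \<X> (X i)) (module_restrict M (X i))"
  proof (rule image_subsetI)
    fix t
    assume "t \<in> Roe_alg \<X> M"
    then have t: "t \<in> cp_alg \<X> M" and lc: "locally_compact_operator \<X> M t"
      unfolding Roe_alg_def by simp_all
    have "block_diagonal t"
      using t cp_alg_subset_ql_Cstar quasi_local_imp_block_diagonal by blast
    then have "locally_compact_operator (coarse_restrict \<X> (X i)) (module_restrict M (X i))
        (compress i t)"
      using lc i by (simp add: locally_compact_block_diagonal_iff)
    moreover have "compress i t \<in> cp_alg (coarse_restrict \<X> (X i)) (module_restrict M (X i))"
      using cp t by (rule image_subset_iff[THEN iffD1, rule_format])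
    ultimately show "compress i t \<in> Roe_alg (coarse_restrict \<X> (X i)) (module_restrict M (X i))"
      unfolding Roe_alg_def by simp
  qed
qed

lemma compress_fixes_component:
  assumes "i \<in> I" and "t \<in> cp_alg (coarse_restrict \<X> (X i)) (module_restrict M (X i)) \<union>
    ql_Cstar (coarse_restrict \<X> (X i)) (module_restrict M (X i)) \<union>
    Roe_alg (coarse_restrict \<X> (X i)) (module_restrict M (X i))"
  shows "compress i t = t"
  using assms compress_component[of i i t]
  unfolding cp_alg_def ql_Cstar_def Roe_alg_def by auto

section \<open>Block diagonal operators as strong sums\<close>

lemma projection_P: "i \<in> I \<Longrightarrow> projection (P i)"
  by (simp add: projection_proj component_meas)

lemma P_orthogonal: "\<lbrakk>i \<in> I; j \<in> I; i \<noteq> j\<rbrakk> \<Longrightarrow> P i o\<^sub>L P j = 0"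
  by (intro blinfun_eqI) (simp add: P_P)

lemma norm_P_le_1: "i \<in> I \<Longrightarrow> norm (P i) \<le> 1"
proof (rule norm_blinfun_bound)
  show "norm (P i v) \<le> 1 * norm v" if "i \<in> I" for v
    using bessel_inequality[of "{i}" P v] that projection_P
    by (simp add: power2_le_iff_abs_le)
qed simp

text \<open>
  Non-degeneracy enters here: a bounded measurable set lies in one component, so the strong sum
  of the \<open>P i\<close> fixes a dense subspace.
\<close>

lemma is_strong_sum_P: "is_strong_sum I P (proj M (points \<X>))"
proof -
  \<comment> \<open>The projections are themselves a family of blocks, of norm at most 1, so they
    have some strong sum \<open>Q\<close>; it remains to identify it.\<close>
  obtain Q where Q: "is_strong_sum I P Q"
    by (rule strong_sum_of_blocks[of I P P 1])
      (auto simp: projection_P P_orthogonal norm_P_le_1 P_P intro!: blinfun_eqI)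
  have fixed: "Q v = v" if "i \<in> I" "P i v = v" for i v
  proof (rule has_sum_unique)
    show "((\<lambda>j. P j v) has_sum Q v) I"
      using Q unfolding is_strong_sum_def by blast
    have "P j v = (if j = i then v else 0)" if "j \<in> I" for j
      using P_P[of j i v] that \<open>i \<in> I\<close> \<open>P i v = v\<close> by auto
    then show "((\<lambda>j. P j v) has_sum v) I"
      using \<open>i \<in> I\<close> by (intro has_sum_finite_neutralI[where B = "{i}"]) auto
  qed
  \<comment> \<open>Non-degeneracy concerns a complex span, so the fixed vectors must also be closed
    under complex scalars.\<close>
  have "complex_vector.subspace {v. Q v = v}"
    using is_strong_sum_scaleC[OF Q] component_meas
    by (auto simp: complex_vector.subspace_def blinfun.add_right proj_scaleC)
  moreover obtain E where E: "gauge_of \<X> E"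
    and dense: "closure (complex_vector.span
      (\<Union>A\<in>{A\<in>meas M. A \<times> A \<subseteq> E}. proj M A ` hilb M)) = hilb M"
    using module unfolding coarse_module_def by blast
  moreover have "Q (proj M A w) = proj M A w" if "A \<in> meas M" "A \<times> A \<subseteq> E" for A w
  proof (cases "A = {}")
    case False
    have "coarsely_bounded \<X> A"
      using E that entourage_mono unfolding gauge_of_def coarsely_bounded_def by blast
    with False obtain i where "i \<in> I" "A \<subseteq> X i"
      using bounded_within_component by blast
    then show ?thesis
      using that by (intro fixed[of i]) (simp_all add: proj_proj component_meas Int_absorb1)
  qed simp
  ultimately have "complex_vector.span
      (\<Union>A\<in>{A\<in>meas M. A \<times> A \<subseteq> E}. proj M A ` hilb M) \<subseteq> {v. Q v = v}"
    by (intro complex_vector.span_minimal) auto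
  moreover have "closed {v. Q v = v}"
    by (intro closed_Collect_eq continuous_intros)
  ultimately have hilb: "hilb M \<subseteq> {v. Q v = v}"
    by (subst dense[symmetric]) (rule closure_minimal)
  \<comment> \<open>For vectors outside \<open>hilb M\<close> both sides depend only on the
    projection to \<open>hilb M\<close>, because each \<open>P i\<close> absorbs it.\<close>
  have "Q v = proj M (points \<X>) v" for v
  proof (rule has_sum_unique)
    show "((\<lambda>i. P i v) has_sum Q v) I"
      using Q unfolding is_strong_sum_def by blast
    have "Q (proj M (points \<X>) v) = proj M (points \<X>) v"
      using hilb unfolding hilb_eq_range by blast
    then have "((\<lambda>i. P i (proj M (points \<X>) v)) has_sum proj M (points \<X>) v) I"
      using Q unfolding is_strong_sum_def by metis
    moreover have "P i (proj M (points \<X>) v) = P i v" if "i \<in> I" for i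
      using component_meas[OF that] meas_subset[of "X i"]
      by (simp add: proj_proj meas_points Int_absorb2)
    ultimately show "((\<lambda>i. P i v) has_sum proj M (points \<X>) v) I"
      by (simp cong: has_sum_cong)
  qed
  then show ?thesis
    using Q unfolding is_strong_sum_def by simp
qed

lemma operator_productD:
  assumes "t \<in> operator_product M I X"
  shows "i \<in> I \<Longrightarrow> t i \<in> operators_on (hilb (module_restrict M (X i)))"
    and "i \<in> I \<Longrightarrow> t i (c *\<^sub>C v) = c *\<^sub>C t i v"
    and "i \<in> I \<Longrightarrow> P i (t i v) = t i v"
    and "i \<in> I \<Longrightarrow> t i (P i v) = t i v"
  using assms operators_on_component_iff[of i] unfolding operator_product_def by blast+

lemma is_strong_sum_strong_sum:
  assumes t: "t \<in> operator_product M I X"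
  shows "is_strong_sum I t (strong_sum I t)"
proof -
  obtain C where C: "\<And>i. i \<in> I \<Longrightarrow> norm (t i) \<le> C"
    using t unfolding operator_product_def bdd_above_def by blast
  \<comment> \<open>The maximum with 0 guards against an empty index set, for which the bound
    \<open>C\<close> could be negative.\<close>
  obtain s where "is_strong_sum I t s"
  proof (rule strong_sum_of_blocks[of I P t "max 0 C"])
    show "norm (t i) \<le> max 0 C" if "i \<in> I" for i
      using C[OF that] by simp
  qed (auto simp: projection_P P_orthogonal operator_productD[OF t] intro!: blinfun_eqI)
  then show ?thesis
    using strong_sum_eqI by metis
qed

text \<open>Multiplying the series by \<open>P i\<close> on either side annihilates every term
  except the one with index \<open>i\<close>.\<close>

lemma strong_sum_P:
  assumes t: "t \<in> operator_product M I X" and i: "i \<in> I"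
  shows "P i (strong_sum I t v) = t i v" and "strong_sum I t (P i v) = t i v"
proof -
  have sums: "((\<lambda>j. t j v) has_sum strong_sum I t v) I" for v
    using is_strong_sum_strong_sum[OF t] unfolding is_strong_sum_def by blast
  have single: "((\<lambda>j. if j = i then t i v else 0) has_sum t i v) I"
    using i by (intro has_sum_finite_neutralI[where B = "{i}"]) auto
  have "P i (t j v) = (if j = i then t i v else 0)" if "j \<in> I" for j
    using P_P[OF i that, of "t j v"] operator_productD[OF t that] by (auto split: if_splits)
  then have "((\<lambda>j. P i (t j v)) has_sum t i v) I"
    using single by (simp cong: has_sum_cong)
  then show "P i (strong_sum I t v) = t i v"
    using has_sum_bounded_linear[OF blinfun.bounded_linear_right sums] by (rule has_sum_unique[rotated])
  have "t j (P i v) = (if j = i then t i v else 0)" if "j \<in> I" for j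
    using P_P[OF that i, of v] operator_productD(4)[OF t that]
    by (metis blinfun.zero_right)
  then have "((\<lambda>j. t j (P i v)) has_sum t i v) I"
    using single by (simp cong: has_sum_cong)
  then show "strong_sum I t (P i v) = t i v"
    using sums by (rule has_sum_unique[rotated])
qed

lemma strong_sum_operators_on:
  assumes t: "t \<in> operator_product M I X"
  shows "strong_sum I t \<in> operators_on (hilb M)"
  unfolding operators_on_hilb_iff
proof (intro conjI allI)
  let ?s = "strong_sum I t"
  note s = is_strong_sum_strong_sum[OF t]
  show "?s (c *\<^sub>C v) = c *\<^sub>C ?s v" for c v
    using s operator_productD(2)[OF t] by (rule is_strong_sum_scaleC)
  have ops: "proj M (points \<X>) (t i v) = t i v" "t i (proj M (points \<X>) v) = t i v" if "i \<in> I" for i v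
    using operators_on_component_subset[OF that operator_productD(1)[OF t that]]
    unfolding operators_on_hilb_iff by blast+
  have sums: "((\<lambda>i. t i v) has_sum ?s v) I" for v
    using s unfolding is_strong_sum_def by blast
  have "((\<lambda>i. t i v) has_sum proj M (points \<X>) (?s v)) I" for v
    using has_sum_bounded_linear[OF blinfun.bounded_linear_right[of "proj M (points \<X>)"] sums[of v]]
    by (simp add: ops cong: has_sum_cong)
  then show "proj M (points \<X>) (?s v) = ?s v" for v
    using sums has_sum_unique by blast
  have "((\<lambda>i. t i v) has_sum ?s (proj M (points \<X>) v)) I" for v
    using sums[of "proj M (points \<X>) v"] by (simp add: ops cong: has_sum_cong)
  then show "?s (proj M (points \<X>) v) = ?s v" for v
    using sums has_sum_unique by blast
qed

lemma block_diagonal_strong_sum: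
  "t \<in> operator_product M I X \<Longrightarrow> block_diagonal (strong_sum I t)"
  unfolding block_diagonal_def
  by (auto intro!: blinfun_eqI simp: strong_sum_operators_on strong_sum_P)

lemma compress_strong_sum:
  "\<lbrakk>t \<in> operator_product M I X; i \<in> I\<rbrakk> \<Longrightarrow> compress i (strong_sum I t) = t i"
  by (intro blinfun_eqI) (simp add: strong_sum_P operator_productD)

text \<open>The corners of the sum recover the blocks, and outside \<open>I\<close> the families of
  \<open>operator_product\<close> have a fixed value.\<close>

lemma inj_on_strong_sum: "inj_on (strong_sum I) (operator_product M I X)"
proof (rule inj_onI)
  fix t u
  assume tu: "t \<in> operator_product M I X" "u \<in> operator_product M I X"
    and eq: "strong_sum I t = strong_sum I u"
  show "t = u"
  proof (rule PiE_ext)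
    show "t i = u i" if "i \<in> I" for i
      using tu eq compress_strong_sum that by metis
  qed (use tu in \<open>auto simp: operator_product_def\<close>)
qed

text \<open>Applying \<open>t\<close> to the expansion of a vector in its components gives a series
  with terms \<open>t (P i v)\<close>, which commutation identifies with the corners. Corners are
  bounded by \<open>norm t\<close> because projections are contractions.\<close>

lemma block_diagonal_decompose:
  assumes t: "block_diagonal t"
  shows "(\<lambda>i\<in>I. compress i t) \<in> operator_product M I X"
    and "strong_sum I (\<lambda>i\<in>I. compress i t) = t"
proof -
  have ops: "t \<in> operators_on (hilb M)"
    using t unfolding block_diagonal_def by blast
  have "norm (compress i t) \<le> norm t" if "i \<in> I" for i
  proof -
    have "norm (compress i t) \<le> norm (P i o\<^sub>L t) * norm (P i)"
      by (rule norm_blinfun_compose)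
    also have "\<dots> \<le> norm (P i) * norm t * norm (P i)"
      by (intro mult_right_mono norm_blinfun_compose norm_ge_zero)
    also have "\<dots> \<le> 1 * norm t * 1"
      by (intro mult_mono norm_P_le_1 that) auto
    finally show ?thesis
      by simp
  qed
  then have "bdd_above ((\<lambda>i. norm ((\<lambda>i\<in>I. compress i t) i)) ` I)"
    by (intro bdd_aboveI[of _ "norm t"]) auto
  then show "(\<lambda>i\<in>I. compress i t) \<in> operator_product M I X"
    using compress_operators_on[OF _ ops] unfolding operator_product_def by auto
  show "strong_sum I (\<lambda>i\<in>I. compress i t) = t"
  proof (rule strong_sum_eqI, unfold is_strong_sum_def, rule allI)
    fix v
    have "((\<lambda>i. t (P i v)) has_sum t (proj M (points \<X>) v)) I"
      using is_strong_sum_P unfolding is_strong_sum_def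
      by (intro has_sum_bounded_linear[OF blinfun.bounded_linear_right]) blast
    moreover have "t (proj M (points \<X>) v) = t v"
      using ops unfolding operators_on_hilb_iff by blast
    ultimately have "((\<lambda>i. t (P i v)) has_sum t v) I"
      by simp
    then show "((\<lambda>i. (\<lambda>i\<in>I. compress i t) i v) has_sum t v) I"
      by (rule has_sum_cong[THEN iffD2, rotated])
        (simp add: block_diagonal_commute[OF t, symmetric] P_P)
  qed
qed

lemma quasi_local_at_strong_sum:
  assumes t: "t \<in> operator_product M I X"
    and local: "\<And>i. i \<in> I \<Longrightarrow> quasi_local_at (module_restrict M (X i)) (t i) \<epsilon> E"
    and "0 \<le> \<epsilon>"
  shows "quasi_local_at M (strong_sum I t) \<epsilon> E"
  unfolding quasi_local_at_def
proof (intro ballI impI)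
  fix B A
  assume BA: "B \<in> meas M" "A \<in> meas M" "separated E B A"
  let ?u = "\<lambda>i. proj M B o\<^sub>L t i o\<^sub>L proj M A"
  \<comment> \<open>Measurable projections commute with the \<open>P i\<close>, so cutting by
    \<open>B\<close> and \<open>A\<close> keeps each operator inside its block.\<close>
  have commute: "P i (proj M C v) = proj M C (P i v)" if "i \<in> I" "C \<in> meas M" for i C v
    using that by (simp add: proj_proj component_meas Int_commute)
  obtain s where s: "is_strong_sum I ?u s" "norm s \<le> \<epsilon>"
  proof (rule strong_sum_of_blocks[of I P ?u \<epsilon>])
    show "norm (?u i) \<le> \<epsilon>" if "i \<in> I" for i
      using quasi_local_at_extend[OF local[OF that] that operator_productD(1)[OF t that]] BA
      unfolding quasi_local_at_def by blast
    show "P i o\<^sub>L ?u i = ?u i" if "i \<in> I" for i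
      using that BA by (intro blinfun_eqI) (simp add: commute operator_productD[OF t])
    show "?u i o\<^sub>L P i = ?u i" if "i \<in> I" for i
      using that BA by (intro blinfun_eqI) (simp flip: commute add: operator_productD[OF t])
  qed (auto simp: projection_P P_orthogonal \<open>0 \<le> \<epsilon>\<close>)
  \<comment> \<open>The corner of the sum is a strong sum of the same family, so uniqueness
    transfers the norm bound to it.\<close>
  moreover have "is_strong_sum I ?u (proj M B o\<^sub>L strong_sum I t o\<^sub>L proj M A)"
    using is_strong_sum_strong_sum[OF t] by (rule is_strong_sum_compose)
  ultimately show "norm (proj M B o\<^sub>L strong_sum I t o\<^sub>L proj M A) \<le> \<epsilon>"
    using is_strong_sum_unique by blast
qed

section \<open>The algebras described by families of blocks and by corners\<close>

lemma strong_sum_image_eqI: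
  assumes "\<And>s. s \<in> R \<Longrightarrow> block_diagonal s \<and> \<Phi> (\<lambda>i\<in>I. compress i s)"
    and "\<And>t. \<lbrakk>t \<in> operator_product M I X; \<Phi> t\<rbrakk> \<Longrightarrow> strong_sum I t \<in> R"
  shows "R = strong_sum I ` {t \<in> operator_product M I X. \<Phi> t}"
proof
  show "R \<subseteq> strong_sum I ` {t \<in> operator_product M I X. \<Phi> t}"
  proof
    fix s
    assume "s \<in> R"
    then show "s \<in> strong_sum I ` {t \<in> operator_product M I X. \<Phi> t}"
      using assms(1) block_diagonal_decompose by (intro image_eqI[of _ _ "\<lambda>i\<in>I. compress i s"]) auto
  qed
qed (use assms(2) in blast)

lemma cp_alg_eq_strong_sums:
  "cp_alg \<X> M = strong_sum I ` {t \<in> operator_product M I X. equi_controlled \<X> M I X t}"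
proof (rule strong_sum_image_eqI)
  show "block_diagonal s \<and> equi_controlled \<X> M I X (\<lambda>i\<in>I. compress i s)"
    if "s \<in> cp_alg \<X> M" for s
    using that quasi_local_imp_block_diagonal cp_alg_subset_ql_Cstar quasi_local_at_compress
    unfolding cp_alg_def equi_controlled_def supp_in_iff_quasi_local_at by auto blast
  show "strong_sum I t \<in> cp_alg \<X> M"
    if "t \<in> operator_product M I X" "equi_controlled \<X> M I X t" for t
    using that quasi_local_at_strong_sum[OF that(1)] strong_sum_operators_on
    unfolding cp_alg_def equi_controlled_def supp_in_iff_quasi_local_at by blast
qed

lemma ql_Cstar_eq_strong_sums:
  "ql_Cstar \<X> M = strong_sum I ` {t \<in> operator_product M I X. equi_quasi_local \<X> M I X t}"
proof (rule strong_sum_image_eqI)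
  show "block_diagonal s \<and> equi_quasi_local \<X> M I X (\<lambda>i\<in>I. compress i s)"
    if s: "s \<in> ql_Cstar \<X> M" for s
  proof
    show "block_diagonal s"
      using s by (rule quasi_local_imp_block_diagonal)
    show "equi_quasi_local \<X> M I X (\<lambda>i\<in>I. compress i s)"
      unfolding equi_quasi_local_def
    proof (intro allI impI)
      fix \<epsilon> :: real
      assume "\<epsilon> > 0"
      then obtain E where "E \<in> entourages \<X>" "quasi_local_at M s \<epsilon> E"
        using s unfolding ql_Cstar_def by blast
      then show "\<exists>E\<in>entourages \<X>. \<forall>i\<in>I.
          quasi_local_at (module_restrict M (X i)) ((\<lambda>i\<in>I. compress i s) i) \<epsilon> E"
        \<comment> \<open>The entourage of the whole operator works for all its corners at once;
          this gives the uniformity in \<open>i\<close>.\<close>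
        by (intro bexI[of _ E]) (simp_all add: quasi_local_at_compress)
    qed
  qed
  show "strong_sum I t \<in> ql_Cstar \<X> M"
    if t: "t \<in> operator_product M I X" "equi_quasi_local \<X> M I X t" for t
    unfolding ql_Cstar_def
  proof (intro CollectI conjI allI impI strong_sum_operators_on[OF t(1)])
    fix \<epsilon> :: real
    assume "\<epsilon> > 0"
    then obtain E where "E \<in> entourages \<X>"
      "\<And>i. i \<in> I \<Longrightarrow> quasi_local_at (module_restrict M (X i)) (t i) \<epsilon> E"
      using t(2) unfolding equi_quasi_local_def by blast
    then show "\<exists>E\<in>entourages \<X>. quasi_local_at M (strong_sum I t) \<epsilon> E"
      using quasi_local_at_strong_sum[OF t(1)] \<open>\<epsilon> > 0\<close> by (meson less_imp_le)
  qed
qed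

text \<open>Local compactness of a strong sum is local compactness of its blocks, so the condition
  can be imposed within the description of \<open>cp_alg\<close>.\<close>

lemma Roe_alg_eq_strong_sums:
  "Roe_alg \<X> M = strong_sum I ` {t \<in> operator_product M I X.
    equi_controlled \<X> M I X t \<and> locally_compact_family \<X> M I X t}"
proof -
  have "locally_compact_operator \<X> M (strong_sum I t) \<longleftrightarrow> locally_compact_family \<X> M I X t"
    if "t \<in> operator_product M I X" for t
    using locally_compact_block_diagonal_iff[OF block_diagonal_strong_sum[OF that]] that
    unfolding locally_compact_family_def by (simp add: compress_strong_sum)
  then show ?thesis
    unfolding Roe_alg_def cp_alg_eq_strong_sums by auto
qed

text \<open>Compression maps each algebra into that of the component, which lies in the former and
  is fixed pointwise. The two norm closures follow because compression is continuous.\<close>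

lemma compress_image:
  assumes "i \<in> I"
  shows "compress i ` cp_alg \<X> M = cp_alg (coarse_restrict \<X> (X i)) (module_restrict M (X i))"
    and "compress i ` Roe_alg \<X> M = Roe_alg (coarse_restrict \<X> (X i)) (module_restrict M (X i))"
    and "compress i ` ql_Cstar \<X> M = ql_Cstar (coarse_restrict \<X> (X i)) (module_restrict M (X i))"
    and "compress i ` cp_Cstar \<X> M = cp_Cstar (coarse_restrict \<X> (X i)) (module_restrict M (X i))"
    and "compress i ` Roe_Cstar \<X> M = Roe_Cstar (coarse_restrict \<X> (X i)) (module_restrict M (X i))"
proof -
  have image: "compress i ` R = S" if "compress i ` R \<subseteq> S" "S \<subseteq> R" "\<And>s. s \<in> S \<Longrightarrow> compress i s = s"
    for R S
    using that by force
  have cont: "continuous_on UNIV (compress i)"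
    by (intro continuous_intros)
  note into = compress_into_component[OF assms] and sub = component_subset[OF assms]
    and fixes_comp = compress_fixes_component[OF assms]
  show "compress i ` cp_alg \<X> M = cp_alg (coarse_restrict \<X> (X i)) (module_restrict M (X i))"
    by (intro image into sub fixes_comp) blast
  show "compress i ` Roe_alg \<X> M = Roe_alg (coarse_restrict \<X> (X i)) (module_restrict M (X i))"
    by (intro image into sub fixes_comp) blast
  show "compress i ` ql_Cstar \<X> M = ql_Cstar (coarse_restrict \<X> (X i)) (module_restrict M (X i))"
    by (intro image into sub fixes_comp) blast
  show "compress i ` cp_Cstar \<X> M = cp_Cstar (coarse_restrict \<X> (X i)) (module_restrict M (X i))"
    unfolding cp_Cstar_def
    by (intro image_closure_retraction cont into sub fixes_comp) blast
  show "compress i ` Roe_Cstar \<X> M = Roe_Cstar (coarse_restrict \<X> (X i)) (module_restrict M (X i))"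
    unfolding Roe_Cstar_def
    by (intro image_closure_retraction cont into sub fixes_comp) blast
qed

end

theorem corollary6p15:
  fixes \<X> :: "'x coarse"
    and M :: "('x, 'h::chilbert_space) cmodule"
    and I :: "'i set"
    and X :: "'i \<Rightarrow> 'x set"
  assumes "coarse_space \<X>"
    and "coarse_components \<X> I X"
    and "coarse_module \<X> M"
    and "admissible \<X> M"
    and "\<And>i. i \<in> I \<Longrightarrow> X i \<in> meas M"
  shows
    "(\<forall>\<R>\<in>{Roe_alg, cp_alg}. \<forall>i\<in>I.
        (\<lambda>t. proj M (X i) o\<^sub>L t o\<^sub>L proj M (X i)) ` \<R> \<X> M
          = \<R> (coarse_restrict \<X> (X i)) (module_restrict M (X i))) \<and>
     (\<forall>\<R>\<in>{Roe_Cstar, cp_Cstar, ql_Cstar}. \<forall>i\<in>I.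
        (\<lambda>t. proj M (X i) o\<^sub>L t o\<^sub>L proj M (X i)) ` \<R> \<X> M
          = \<R> (coarse_restrict \<X> (X i)) (module_restrict M (X i))) \<and>
     (\<forall>t\<in>operator_product M I X.
        is_strong_sum I t (strong_sum I t) \<and> strong_sum I t \<in> operators_on (hilb M)) \<and>
     inj_on (strong_sum I) (operator_product M I X) \<and>
     cp_alg \<X> M = strong_sum I `
       {t \<in> operator_product M I X. equi_controlled \<X> M I X t} \<and>
     Roe_alg \<X> M = strong_sum I `
       {t \<in> operator_product M I X.
          equi_controlled \<X> M I X t \<and> locally_compact_family \<X> M I X t} \<and>
     ql_Cstar \<X> M = strong_sum I `
       {t \<in> operator_product M I X. equi_quasi_local \<X> M I X t} \<and>
     cp_Cstar \<X> M = closure (strong_sum I `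
       {t \<in> operator_product M I X. equi_controlled \<X> M I X t}) \<and>
     Roe_Cstar \<X> M = closure (strong_sum I `
       {t \<in> operator_product M I X.
          equi_controlled \<X> M I X t \<and> locally_compact_family \<X> M I X t})"
proof -
  interpret coarse_decomposition \<X> M I X
    using assms by unfold_locales
  show ?thesis
    \<comment> \<open>The families are folded back into the algebras, so the two closure identities
      reduce to the definitions.\<close>
    unfolding cp_Cstar_def[of \<X> M] Roe_Cstar_def[of \<X> M]
      cp_alg_eq_strong_sums[symmetric] Roe_alg_eq_strong_sums[symmetric]
      ql_Cstar_eq_strong_sums[symmetric]
    using is_strong_sum_strong_sum strong_sum_operators_on inj_on_strong_sum compress_image
    by (auto simp: cp_Cstar_def Roe_Cstar_def)
qed

end
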